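(* Let $\lambda_\rho=\sum_{k=0}^\infty\rho^kK_k$ and $f_\rho=\sum_{m=0}^\infty\rho^mg_m$ be the power series expansions (for $\rho$ near $0$) of the largest eigenvalue of $T_\rho$ and of the corresponding eigenfunction, the latter normalized by $f_\rho(0)=1$. For all $m\in\mathbb{N}$ the function $g_m$ is a polynomial of degree at most $m$. A full iterative description of the $g_m$, $m\in\mathbb{N}$, is given by $g_0=1$ (the constant function), $K_0=\frac12$, $g_m(0)=0$ for $m\ge1$, and $$g_m=\frac{1}{K_0}\left(\sum_{j=1}^m T^{(j)}g_{m-j}-\sum_{j=1}^{m-1}\big(T^{(0)}g_j\big)\cdot g_{m-j}\right),\qquad m\ge1 .$$ Further, the $K_n$, $n\ge1$, can be computed using $$K_n=T^{(0)}g_n .$$ The first coefficients are given by \begin{align*} K_0&=\tfrac12,\\ K_1&=\tfrac1\pi,\\ K_2&=-\tfrac{2}{\pi^2},\\ K_3&=-\tfrac{5}{6\pi}+\tfrac{8}{\pi^3},\\ K_4&=\tfrac{13}{3\pi^2}-\tfrac{40}{\pi^4},\\ K_5&=\tfrac{23}{40\pi}-\tfrac{28}{\pi^3}+\tfrac{224}{\pi^5},\\ K_6&=-\tfrac{1069}{180\pi^2}+\tfrac{580}{3\pi^4}-\tfrac{1344}{\pi^6},\\ K_7&=-\tfrac{37}{112\pi}+\tfrac{842}{15\pi^3}-\tfrac{4144}{3\pi^5}+\tfrac{8448}{\pi^7},\\ K_8&=\tfrac{943}{168\pi^2}-\tfrac{1535}{3\pi^4}+\tfrac{10080}{\pi^6}-\tfrac{54912}{\pi^8}.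 \end{align*}
   Context: $\mathbb{N}=\{0,1,2,\dots\}$ and $\phi(x)=(2\pi)^{-1/2}e^{-x^2/2}$. Let $h_n(x)=(-1)^n e^{x^2/2}\frac{d^n}{dx^n}e^{-x^2/2}$ be the $n$-th Hermite polynomial and $\hat h_n:=(n!)^{-1/2}h_n$. Fix $0<q<1$ and let $$\mathcal{H}_q:=\Big\{f\colon\mathbb{R}\to\mathbb{C},\ f(x)=\sum_{n=0}^\infty a_n\hat h_n(x)\ \text{with } a_n\in\mathbb{C},\ \sum_{n=0}^\infty|a_n|^2q^{-n}<\infty\Big\},$$ a complex Hilbert space with inner product $\langle f,g\rangle_{\mathcal{H}_q}:=\sum_{n}a_n\overline{b_n}q^{-n}$ for $f=\sum a_n\hat h_n$, $g=\sum b_n\hat h_n$. For $|\rho|<\sqrt{\frac{1-q}{1+q^{-1}}}$ define $T_\rho\colon\mathcal{H}_q\to\mathcal{H}_q$, $T_\rho f(x):=\int_{-\rho x}^\infty f(y)\phi(y)\,dy$; this is a compact operator with norm-convergent expansion $T_\rho=\sum_{k=0}^\infty\rho^kT^{(k)}$, where $$T^{(n)}f(x):=(-1)^nx^n\frac{1}{n!}\int_0^\infty(f\phi)^{(n)}(y)\,dy .$$ In particular $T^{(0)}f=\int_0^\infty f(y)\phi(y)\,dy$ is a constant function, identified with a number. Let $\lambda_\rho=r(T_\rho)$ (spectral radius), the largest eigenvalue of $T_\rho$ (at $\rho=0$ it equals $\frac12$ and is algebraically simple), and $f_\rho$ a corresponding eigenfunction, $T_\rho f_\rho=\lambda_\rho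 f_\rho$. By analytic perturbation theory, for $\rho$ in a neighbourhood of $0$ both can be expanded in convergent power series in $\rho$, with coefficients $K_k\in\mathbb{R}$ and $g_m\in\mathcal{H}_q$ respectively. *)

theory Defs
  imports "HOL-Probability.Distributions" "HOL-Computational_Algebra.Polynomial"
begin

definition hermite :: "nat \<Rightarrow> real \<Rightarrow> real" where
  "hermite n x = (-1) ^ n * exp (x\<^sup>2 / 2) * (deriv ^^ n) (\<lambda>t. exp (- (t\<^sup>2 / 2))) x"

definition hermite_normalized :: "nat \<Rightarrow> real \<Rightarrow> real" where
  "hermite_normalized n x = hermite n x / sqrt (fact n)"

definition hermite_expansion :: "real \<Rightarrow> (nat \<Rightarrow> complex) \<Rightarrow> (real \<Rightarrow> complex) \<Rightarrow> bool" where
  "hermite_expansion q a f \<longleftrightarrow>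
     summable (\<lambda>n. (cmod (a n))\<^sup>2 / q ^ n) \<and>
     (\<forall>x. (\<lambda>n. a n * of_real (hermite_normalized n x)) sums f x)"

definition Hq :: "real \<Rightarrow> (real \<Rightarrow> complex) set" where
  "Hq q = {f. \<exists>a. hermite_expansion q a f}"

(* For 0 < q < 1 and f in Hq q the sequence a is unique: the series also converges in the
   Gaussian-weighted L^2 space, where the normalized Hermite polynomials are orthonormal. *)
definition hermite_coeff :: "real \<Rightarrow> (real \<Rightarrow> complex) \<Rightarrow> nat \<Rightarrow> complex" where
  "hermite_coeff q f = (THE a. hermite_expansion q a f)"

definition Hq_inner :: "real \<Rightarrow> (real \<Rightarrow> complex) \<Rightarrow> (real \<Rightarrow> complex) \<Rightarrow> complex" where
  "Hq_inner q f g =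
     (\<Sum>n. hermite_coeff q f n * cnj (hermite_coeff q g n) / of_real (q ^ n))"

definition Hq_norm :: "real \<Rightarrow> (real \<Rightarrow> complex) \<Rightarrow> real" where
  "Hq_norm q f = sqrt (Re (Hq_inner q f f))"

definition Hq_bounded_operator ::
    "real \<Rightarrow> ((real \<Rightarrow> complex) \<Rightarrow> (real \<Rightarrow> complex)) \<Rightarrow> bool" where
  "Hq_bounded_operator q S \<longleftrightarrow>
     (\<forall>f\<in>Hq q. S f \<in> Hq q) \<and>
     (\<forall>f\<in>Hq q. \<forall>g\<in>Hq q. S (\<lambda>x. f x + g x) = (\<lambda>x. S f x + S g x)) \<and>
     (\<forall>c. \<forall>f\<in>Hq q. S (\<lambda>x. c * f x) = (\<lambda>x. c * S f x)) \<and>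
     (\<exists>C. \<forall>f\<in>Hq q. Hq_norm q (S f) \<le> C * Hq_norm q f)"

(* Spectrum of the operator that A induces on Hq q: the complex numbers z for which A - z has
   no bounded two-sided inverse on Hq q. *)
definition Hq_spectrum ::
    "real \<Rightarrow> ((real \<Rightarrow> complex) \<Rightarrow> (real \<Rightarrow> complex)) \<Rightarrow> complex set" where
  "Hq_spectrum q A =
     {z. \<not> (\<exists>S. Hq_bounded_operator q S \<and>
                (\<forall>f\<in>Hq q. S (\<lambda>x. A f x - z * f x) = f \<and>
                          (\<lambda>x. A (S f) x - z * S f x) = f))}"

definition Hq_spectral_radius ::
    "real \<Rightarrow> ((real \<Rightarrow> complex) \<Rightarrow> (real \<Rightarrow> complex)) \<Rightarrow> real" where
  "Hq_spectral_radius q A = (SUP z \<in> Hq_spectrum q A. cmod z)"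

definition T_op :: "real \<Rightarrow> (real \<Rightarrow> complex) \<Rightarrow> real \<Rightarrow> complex" where
  "T_op \<rho> f x =
     set_lebesgue_integral lborel {- \<rho> * x..} (\<lambda>y. f y * of_real (std_normal_density y))"

(* The n-th derivative of a complex-valued function of a real variable is the n-fold iterate of
   vector_derivative. *)
definition T_coeff :: "nat \<Rightarrow> (real \<Rightarrow> complex) \<Rightarrow> real \<Rightarrow> complex" where
  "T_coeff n f x =
     (-1) ^ n * of_real (x ^ n) * (1 / fact n) *
     set_lebesgue_integral lborel {0..}
       (((\<lambda>F y. vector_derivative F (at y)) ^^ n) (\<lambda>y. f y * of_real (std_normal_density y)))"

end

theory Submission
  imports Defs "HOL-Library.Landau_Symbols"
begin

text \<open>At \<open>\<rho> = 0\<close> the operator has rank one: it sends \<open>h\<close> to the constant \<open>\<integral>\<^sub>0\<^sup>\<infinity> h \<phi>\<close>. Its spectrum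
therefore lies in \<open>{0, 1/2}\<close> and contains \<open>1/2\<close>, the eigenvalue of the constants; an
explicit bounded resolvent proves this (\<open>spectral_radius_T_op_0\<close>). Hence \<open>K 0 = 1/2\<close>, which is the
only information about spectral radii that the argument needs: for \<open>\<rho> \<noteq> 0\<close> everything
follows from the eigenvalue equation and the two expansions.

Write \<open>\<integral>\<^sub>t\<^sup>\<infinity> h \<phi>\<close> as \<open>gauss_tail h t\<close>, so that \<open>T_op \<rho> h x = gauss_tail h (- \<rho> x)\<close>. Point evaluations and
Gaussian tails are bounded linear functionals on the Hermite space, the latter with one bound that serves
all \<open>t\<close>. Thus, for fixed \<open>x\<close>, the expansion of \<open>f \<rho>\<close> in norm turns into a power series for
\<open>f \<rho> x\<close>, and \<open>T_op \<rho> (f \<rho>) x\<close> agrees with \<open>\<Sum>m\<le>M. \<rho> ^ m * gauss_tail (g m) (- \<rho> x)\<close> up to \<open>o(\<rho> ^ M)\<close>.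

The coefficients are then compared order by order. Suppose that \<open>g m\<close> is a real polynomial for every
\<open>m < M\<close>. For polynomials, Taylor's formula for \<open>u \<mapsto> \<integral>\<^sub>-\<^sub>u\<^sup>\<infinity> p \<phi>\<close> is elementary and its coefficients
are those of \<open>T_coeff\<close>; for \<open>g M\<close> itself, which is only known to lie in the space, continuity of its
tail suffices because it enters with the factor \<open>\<rho> ^ M\<close>. The coefficients of \<open>\<rho> ^ M\<close> give
\<open>\<Sum>k\<le>M. K k * g (M - k) = \<Sum>j\<le>M. T_coeff j (g (M - j))\<close> (\<open>order_equation\<close>). At \<open>x = 0\<close> the normalization
\<open>f \<rho> 0 = 1\<close> reduces this to \<open>K M = T_coeff 0 (g M)\<close>. The term with \<open>T_coeff 0 (g M)\<close> therefore
cancels against \<open>K M * g 0\<close>, and what remains is the recursion. It expresses \<open>g M\<close> through its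
predecessors and powers \<open>x ^ j\<close> with \<open>j \<le> M\<close>, so \<open>g M\<close> is a real polynomial of degree at most
\<open>M\<close> and the induction continues.

The first eight coefficients come from running this recursion on coefficient lists. With \<open>s = \<phi> 0\<close>
all quantities are rational polynomials in \<open>s\<close>, and \<open>s\<^sup>2 = 1 / (2 * pi)\<close>.\<close>

section \<open>Polynomials against the Gaussian density\<close>

text \<open>The operator \<open>p \<mapsto> p' - x p\<close>, that is, differentiation conjugated with the Gaussian density. It makes
derivatives of \<open>p \<phi>\<close>, Hermite polynomials and integration by parts a matter of polynomial algebra.\<close>

definition gauss_deriv :: "real poly \<Rightarrow> real poly" where
  "gauss_deriv p = pderiv p - pCons 0 p"

lemma has_real_derivative_poly_gauss:
  "((\<lambda>x. poly p x * std_normal_density x) has_real_derivative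
     poly (gauss_deriv p) x * std_normal_density x) (at x)"
proof -
  have "((\<lambda>x. (1 / sqrt (2 * pi)) * (poly p x * exp (- x\<^sup>2 / 2))) has_real_derivative
     (1 / sqrt (2 * pi)) * (poly (gauss_deriv p) x * exp (- x\<^sup>2 / 2))) (at x)"
    by (rule DERIV_cmult)
       (auto intro!: derivative_eq_intros simp: gauss_deriv_def algebra_simps)
  then show ?thesis by (simp add: std_normal_density_def)
qed

lemma integrable_poly_gauss: "integrable lborel (\<lambda>x. poly p x * std_normal_density x)"
proof -
  have "integrable lborel (\<lambda>x. \<Sum>i\<le>degree p. coeff p i * (std_normal_density x * x ^ i))"
    by (intro Bochner_Integration.integrable_sum integrable_mult_right integrable_std_normal_moment)
  also have "(\<lambda>x. \<Sum>i\<le>degree p. coeff p i * (std_normal_density x * x ^ i)) =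
      (\<lambda>x. poly p x * std_normal_density x)"
    by (simp add: poly_altdef sum_distrib_left mult_ac fun_eq_iff)
  finally show ?thesis .
qed

lemma tendsto_power_gauss_at_top: "((\<lambda>x. x ^ k * exp (- x\<^sup>2 / 2)) \<longlongrightarrow> (0::real)) at_top"
proof (rule tendsto_sandwich[where f = "\<lambda>_. 0" and h = "\<lambda>x. x ^ k / exp x"])
  show "((\<lambda>x. x ^ k / exp x) \<longlongrightarrow> (0::real)) at_top"
    by (rule tendsto_power_div_exp_0)
  show "\<forall>\<^sub>F x in at_top. 0 \<le> x ^ k * exp (- (x::real)\<^sup>2 / 2)"
    using eventually_ge_at_top[of 0] by eventually_elim auto
  show "\<forall>\<^sub>F x in at_top. x ^ k * exp (- x\<^sup>2 / 2) \<le> x ^ k / exp (x::real)"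
    using eventually_ge_at_top[of 2]
  proof eventually_elim
    case (elim x)
    have "x * 2 \<le> x * x" using elim by (intro mult_left_mono) auto
    then have "exp (- x\<^sup>2 / 2) \<le> exp (- x)" by (simp add: power2_eq_square)
    then have "x ^ k * exp (- x\<^sup>2 / 2) \<le> x ^ k * exp (- x)" using elim by (intro mult_left_mono) auto
    then show ?case by (simp only: exp_minus divide_inverse)
  qed
qed auto

lemma tendsto_poly_gauss_at_top: "((\<lambda>x. poly p x * std_normal_density x) \<longlongrightarrow> 0) at_top"
proof -
  have "((\<lambda>x. \<Sum>i\<le>degree p. (coeff p i / sqrt (2 * pi)) * (x ^ i * exp (- x\<^sup>2 / 2))) \<longlongrightarrow>
      (\<Sum>i\<le>degree p. (coeff p i / sqrt (2 * pi)) * 0)) at_top"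
    by (intro tendsto_sum tendsto_mult_left tendsto_power_gauss_at_top)
  also have "(\<lambda>x. \<Sum>i\<le>degree p. (coeff p i / sqrt (2 * pi)) * (x ^ i * exp (- x\<^sup>2 / 2))) =
      (\<lambda>x. poly p x * std_normal_density x)"
    by (simp add: poly_altdef sum_distrib_left sum_divide_distrib std_normal_density_def mult_ac fun_eq_iff)
  finally show ?thesis by simp
qed

lemma std_normal_density_minus [simp]: "std_normal_density (- x) = std_normal_density x"
  by (simp add: std_normal_density_def)

lemma tendsto_poly_gauss_at_bot: "((\<lambda>x. poly p x * std_normal_density x) \<longlongrightarrow> 0) at_bot"
proof -
  have "((\<lambda>x. poly (pcompose p [:0, -1:]) x * std_normal_density x) \<longlongrightarrow> 0) at_top"
    by (rule tendsto_poly_gauss_at_top)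
  then show ?thesis
    unfolding at_bot_mirror filterlim_filtermap by (simp add: poly_pcompose)
qed

lemma set_integral_atLeast_eq_greaterThan:
  fixes f :: "real \<Rightarrow> 'a::{banach, second_countable_topology}"
  assumes "f \<in> borel_measurable lborel"
  shows "set_lebesgue_integral lborel {t..} f = set_lebesgue_integral lborel {t<..} f"
unfolding set_lebesgue_integral_def
proof (rule integral_cong_AE)
  show "AE x in lborel. indicator {t..} x *\<^sub>R f x = indicator {t<..} x *\<^sub>R f x"
    using AE_lborel_singleton[of t] by eventually_elim (auto simp: indicator_def)
qed (use assms in auto)

lemma isCont_poly_gauss: "isCont (\<lambda>x. poly p x * std_normal_density x) x"
  using has_real_derivative_poly_gauss DERIV_isCont by blast

lemma measurable_poly_gauss: "(\<lambda>x. poly p x * std_normal_density x) \<in> borel_measurable borel"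
  by (intro borel_measurable_continuous_onI continuous_at_imp_continuous_on ballI isCont_poly_gauss)

text \<open>The fundamental theorem of calculus on a half line: \<open>p \<phi>\<close> is a primitive that vanishes at infinity.
The moments and Taylor coefficients below rest on this identity, and orthogonality of the Hermite
polynomials on its two-sided analogue.\<close>

lemma tail_integral_gauss_deriv:
  "(LINT x:{t..}|lborel. poly (gauss_deriv p) x * std_normal_density x) = - (poly p t * std_normal_density t)"
proof -
  have 1: "set_integrable lborel (einterval (ereal t) \<infinity>) (\<lambda>x. poly (gauss_deriv p) x * std_normal_density x)"
    unfolding set_integrable_def
    by (intro integrable_mult_indicator integrable_poly_gauss) auto
  have "(LBINT x=ereal t..\<infinity>. poly (gauss_deriv p) x * std_normal_density x) = 0 - poly p t * std_normal_density t"
  proof (rule interval_integral_FTC_integrable)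
    show "((\<lambda>x. poly p x * std_normal_density x) has_vector_derivative
        poly (gauss_deriv p) x * std_normal_density x) (at x)" for x
      using has_real_derivative_poly_gauss by (simp add: has_real_derivative_iff_has_vector_derivative)
    show "(((\<lambda>x. poly p x * std_normal_density x) \<circ> real_of_ereal) \<longlongrightarrow> poly p t * std_normal_density t) (at_right (ereal t))"
      using isCont_poly_gauss[where p = p and x = t]
      by (simp add: ereal_tendsto_simps1 isCont_def filterlim_at_split)
    show "(((\<lambda>x. poly p x * std_normal_density x) \<circ> real_of_ereal) \<longlongrightarrow> 0) (at_left \<infinity>)"
      unfolding ereal_tendsto_simps1 by (rule tendsto_poly_gauss_at_top)
  qed (use 1 isCont_poly_gauss in auto)
  then show ?thesis
    by (simp add: interval_integral_to_infinity_eq set_integral_atLeast_eq_greaterThan measurable_poly_gauss)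
qed

definition gauss_mean :: "real poly \<Rightarrow> real" where
  "gauss_mean p = (LBINT x. poly p x * std_normal_density x)"

definition half_gauss_mean :: "real poly \<Rightarrow> real" where
  "half_gauss_mean p = (LINT x:{0..}|lborel. poly p x * std_normal_density x)"

lemma gauss_mean_gauss_deriv: "gauss_mean (gauss_deriv p) = 0"
proof -
  have 1: "set_integrable lborel (einterval (-\<infinity>) \<infinity>) (\<lambda>x. poly (gauss_deriv p) x * std_normal_density x)"
    unfolding set_integrable_def
    by (intro integrable_mult_indicator integrable_poly_gauss) auto
  have "(LBINT x=-\<infinity>..\<infinity>. poly (gauss_deriv p) x * std_normal_density x) = 0 - 0"
  proof (rule interval_integral_FTC_integrable)
    show "((\<lambda>x. poly p x * std_normal_density x) has_vector_derivative
        poly (gauss_deriv p) x * std_normal_density x) (at x)" for x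
      using has_real_derivative_poly_gauss by (simp add: has_real_derivative_iff_has_vector_derivative)
    show "(((\<lambda>x. poly p x * std_normal_density x) \<circ> real_of_ereal) \<longlongrightarrow> 0) (at_right (-\<infinity>))"
      unfolding ereal_tendsto_simps1 by (rule tendsto_poly_gauss_at_bot)
    show "(((\<lambda>x. poly p x * std_normal_density x) \<circ> real_of_ereal) \<longlongrightarrow> 0) (at_left \<infinity>)"
      unfolding ereal_tendsto_simps1 by (rule tendsto_poly_gauss_at_top)
  qed (use 1 isCont_poly_gauss in auto)
  then show ?thesis
    by (simp add: gauss_mean_def interval_lebesgue_integral_def set_lebesgue_integral_def)
qed

lemma gauss_mean_add: "gauss_mean (p + r) = gauss_mean p + gauss_mean r"
  unfolding gauss_mean_def
  by (simp add: distrib_right Bochner_Integration.integral_add[OF integrable_poly_gauss integrable_poly_gauss])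

lemma gauss_mean_smult: "gauss_mean (smult c p) = c * gauss_mean p"
  unfolding gauss_mean_def by (simp add: mult.assoc)

lemma half_gauss_mean_add: "half_gauss_mean (p + r) = half_gauss_mean p + half_gauss_mean r"
proof -
  have "set_integrable lborel {0..} (\<lambda>x. poly s x * std_normal_density x)" for s
    unfolding set_integrable_def by (intro integrable_mult_indicator integrable_poly_gauss) auto
  then show ?thesis
    unfolding half_gauss_mean_def poly_add distrib_right by (intro set_integral_add(2))
qed

lemma half_gauss_mean_smult: "half_gauss_mean (smult c p) = c * half_gauss_mean p"
  unfolding half_gauss_mean_def by (simp add: mult.assoc)

text \<open>By symmetry of the density.\<close>

lemma half_gauss_mean_1: "half_gauss_mean 1 = 1 / 2"
proof -
  let ?f = "std_normal_density"
  have i: "set_integrable lborel {0..} ?f" "set_integrable lborel {..0} ?f"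
    unfolding set_integrable_def by (intro integrable_mult_indicator; simp)+
  have "(LINT x:{..0}|lborel. ?f x) = (LINT x:{0..}|lborel. ?f x)"
    using set_integral_reflect[of "{..0}" ?f] by (simp add: atLeast_def)
  moreover have "(LINT x:{..0} \<union> {0..}|lborel. ?f x) = (LINT x:{..0}|lborel. ?f x) + (LINT x:{0..}|lborel. ?f x)"
  proof (rule set_integral_Un_AE)
    show "AE x in lborel. \<not> (x \<in> {..0} \<and> x \<in> {0::real..})"
      using AE_lborel_singleton[of 0] by eventually_elim auto
  qed (use i in auto)
  moreover have "{..0} \<union> {0..} = (UNIV :: real set)" by auto
  moreover have "(LINT x:UNIV|lborel. ?f x) = 1"
    by (simp add: set_lebesgue_integral_def)
  ultimately show ?thesis by (simp add: half_gauss_mean_def)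
qed

lemma half_gauss_mean_gauss_deriv: "half_gauss_mean (gauss_deriv p) = - (poly p 0 * std_normal_density 0)"
  by (simp add: half_gauss_mean_def tail_integral_gauss_deriv)

section \<open>Hermite polynomials\<close>

primrec hermite_poly :: "nat \<Rightarrow> real poly" where
  "hermite_poly 0 = 1"
| "hermite_poly (Suc n) = - gauss_deriv (hermite_poly n)"

lemma hermite_eq_poly: "hermite n = poly (hermite_poly n)"
proof
  fix x
  have "(deriv ^^ n) (\<lambda>t. exp (- (t\<^sup>2 / 2))) = (\<lambda>t. (-1) ^ n * poly (hermite_poly n) t * exp (- (t\<^sup>2 / 2)))"
  proof (induction n)
    case (Suc n)
    have "deriv (\<lambda>t. (-1) ^ n * poly (hermite_poly n) t * exp (- (t\<^sup>2 / 2))) =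
        (\<lambda>t. (-1) ^ Suc n * poly (hermite_poly (Suc n)) t * exp (- (t\<^sup>2 / 2)))"
      by (rule ext, rule DERIV_imp_deriv)
         (auto intro!: derivative_eq_intros simp: gauss_deriv_def algebra_simps)
    then show ?case by (simp add: Suc.IH)
  qed simp
  then show "hermite n x = poly (hermite_poly n) x"
    by (simp add: hermite_def flip: power_mult_distrib exp_add)
       (simp add: mult.assoc mult.left_commute flip: exp_add)
qed

text \<open>Differentiation lowers the index. Inserted into the definition, this gives the three-term recurrence, which
controls the growth at a fixed point.\<close>

lemma pderiv_hermite_poly: "pderiv (hermite_poly (Suc n)) = smult (real (Suc n)) (hermite_poly n)"
proof (induction n)
  case 0
  then show ?case by (simp add: gauss_deriv_def pderiv_pCons one_pCons)
next
  case (Suc n)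
  have "pderiv (hermite_poly (Suc (Suc n))) = 
     hermite_poly (Suc n) + pCons 0 (pderiv (hermite_poly (Suc n))) - pderiv (pderiv (hermite_poly (Suc n)))"
    by (simp add: gauss_deriv_def pderiv_diff pderiv_minus pderiv_pCons)
  also have "\<dots> = hermite_poly (Suc n) + smult (real (Suc n)) (hermite_poly (Suc n))"
    unfolding Suc.IH by (simp add: gauss_deriv_def pderiv_smult algebra_simps smult_diff_right)
  also have "\<dots> = smult (1 + real (Suc n)) (hermite_poly (Suc n))"
    by (simp only: smult_add_left smult_1_left)
  also have "\<dots> = smult (real (Suc (Suc n))) (hermite_poly (Suc n))"
    by (simp only: of_nat_Suc)
  finally show ?case .
qed

lemma hermite_poly_recurrence:
  "poly (hermite_poly (Suc (Suc n))) x = x * poly (hermite_poly (Suc n)) x - real (Suc n) * poly (hermite_poly n) x"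
  using pderiv_hermite_poly[of n] by (simp add: gauss_deriv_def del: of_nat_Suc)

text \<open>Integration by parts: multiplication by a Hermite polynomial is adjoint to repeated differentiation.
Orthogonality follows by lowering both indices together.\<close>

lemma gauss_mean_hermite_poly_Suc_mult:
  "gauss_mean (hermite_poly (Suc n) * p) = gauss_mean (hermite_poly n * pderiv p)"
proof -
  have "gauss_deriv (hermite_poly n * p) = hermite_poly n * pderiv p + smult (-1) (hermite_poly (Suc n) * p)"
    by (simp add: gauss_deriv_def pderiv_mult algebra_simps)
  then have "gauss_mean (hermite_poly n * pderiv p) + (-1) * gauss_mean (hermite_poly (Suc n) * p) = 0"
    by (metis gauss_mean_add gauss_mean_smult gauss_mean_gauss_deriv)
  then show ?thesis by simp
qed

lemma gauss_mean_hermite_poly_mult: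
  "gauss_mean (hermite_poly n * hermite_poly m) = (if n = m then fact n else 0)"
proof (induction n arbitrary: m)
  case 0
  show ?case
  proof (cases m)
    case 0
    then show ?thesis by (simp add: gauss_mean_def)
  next
    case (Suc k)
    then show ?thesis using gauss_mean_hermite_poly_Suc_mult[of k 1] by (simp add: gauss_mean_def)
  qed
next
  case (Suc n)
  show ?case
  proof (cases m)
    case 0
    then show ?thesis using gauss_mean_hermite_poly_Suc_mult[of n 1] by (simp add: gauss_mean_def)
  next
    case (Suc k)
    then show ?thesis
      using gauss_mean_hermite_poly_Suc_mult[of n "hermite_poly (Suc k)"] Suc.IH[of k]
      by (simp add: pderiv_hermite_poly gauss_mean_smult del: hermite_poly.simps)
  qed
qed

lemma hermite_normalized_poly: "hermite_normalized n x = poly (hermite_poly n) x / sqrt (fact n)"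
  by (simp add: hermite_normalized_def hermite_eq_poly)

lemma integrable_hermite_normalized_mult:
  "integrable lborel (\<lambda>x. hermite_normalized n x * hermite_normalized m x * std_normal_density x)"
proof -
  have "integrable lborel (\<lambda>x. poly (hermite_poly n * hermite_poly m) x * std_normal_density x / (sqrt (fact n) * sqrt (fact m)))"
    by (intro integrable_divide integrable_poly_gauss)
  then show ?thesis by (simp add: hermite_normalized_poly)
qed

lemma hermite_normalized_orthonormal:
  "(LBINT x. hermite_normalized n x * hermite_normalized m x * std_normal_density x) = (if n = m then 1 else 0)"
proof -
  have "(LBINT x. hermite_normalized n x * hermite_normalized m x * std_normal_density x) =
     (LBINT x. poly (hermite_poly n * hermite_poly m) x * std_normal_density x / (sqrt (fact n) * sqrt (fact m)))"
    by (simp add: hermite_normalized_poly)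
  also have "\<dots> = gauss_mean (hermite_poly n * hermite_poly m) / (sqrt (fact n) * sqrt (fact m))"
    by (simp add: gauss_mean_def)
  finally show ?thesis by (simp add: gauss_mean_hermite_poly_mult)
qed

text \<open>Since \<open>\<bar>a b\<bar> \<le> (a\<^sup>2 + b\<^sup>2) / 2\<close> and the normalized polynomials have unit Gaussian norm.\<close>

lemma integral_abs_hermite_normalized_mult_le_1:
  "(LBINT x. \<bar>hermite_normalized n x * hermite_normalized m x * std_normal_density x\<bar>) \<le> 1"
proof -
  have "(LBINT x. \<bar>hermite_normalized n x * hermite_normalized m x * std_normal_density x\<bar>) \<le>
    (LBINT x. (hermite_normalized n x * hermite_normalized n x * std_normal_density x +
        hermite_normalized m x * hermite_normalized m x * std_normal_density x) / 2)"
  proof (rule integral_mono)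
    fix x
    have "\<bar>a * b\<bar> \<le> (a * a + b * b) / 2" for a b :: real
      using sum_squares_bound[of "\<bar>a\<bar>" "\<bar>b\<bar>"] by (simp add: abs_mult power2_eq_square)
    then have "\<bar>hermite_normalized n x * hermite_normalized m x\<bar> * std_normal_density x \<le>
      ((hermite_normalized n x * hermite_normalized n x + hermite_normalized m x * hermite_normalized m x) / 2) * std_normal_density x"
      by (intro mult_right_mono) auto
    then show "\<bar>hermite_normalized n x * hermite_normalized m x * std_normal_density x\<bar> \<le>
      (hermite_normalized n x * hermite_normalized n x * std_normal_density x +
        hermite_normalized m x * hermite_normalized m x * std_normal_density x) / 2"
      by (simp add: abs_mult algebra_simps)
  qed (intro integrable_abs integrable_divide Bochner_Integration.integrable_add integrable_hermite_normalized_mult)+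
  also have "\<dots> = 1"
    by (subst integral_divide_zero, subst Bochner_Integration.integral_add)
       (auto intro: integrable_hermite_normalized_mult simp: hermite_normalized_orthonormal)
  finally show ?thesis .
qed

section \<open>Hermite expansions\<close>

text \<open>In the normalized recurrence the first factor tends to zero and the second is at most one. This is why
the values at a fixed point grow more slowly than any geometric sequence.\<close>

lemma hermite_normalized_recurrence_bound:
  "\<bar>hermite_normalized (Suc (Suc n)) x\<bar> \<le>
     \<bar>x\<bar> / sqrt (real (Suc (Suc n))) * \<bar>hermite_normalized (Suc n) x\<bar> + \<bar>hermite_normalized n x\<bar>"
proof -
  let ?a = "sqrt (real (Suc (Suc n)))" and ?b = "sqrt (real (Suc n))" and ?c = "sqrt (fact n)"
  have pos: "?a > 0" "?b > 0" "?c > 0" by simp_all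
  have f: "sqrt (fact (Suc n)) = ?b * ?c" "sqrt (fact (Suc (Suc n))) = ?a * ?b * ?c"
    by (simp_all only: fact_Suc of_nat_mult real_sqrt_mult mult.assoc of_nat_fact)
  have b2: "real (Suc n) = ?b * ?b" by simp
  have ba: "?b / ?a \<le> 1" by simp
  let ?h = "\<lambda>k. poly (hermite_poly k) x"
  have "hermite_normalized (Suc (Suc n)) x = (x * ?h (Suc n) - (?b * ?b) * ?h n) / (?a * ?b * ?c)"
    unfolding hermite_normalized_poly hermite_poly_recurrence f(2) b2[symmetric] ..
  also have "\<dots> = x / ?a * (?h (Suc n) / (?b * ?c)) - ?b / ?a * (?h n / ?c)"
    using pos by (simp add: field_simps del: of_nat_Suc hermite_poly.simps)
  also have "\<dots> = x / ?a * hermite_normalized (Suc n) x - ?b / ?a * hermite_normalized n x"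
    unfolding hermite_normalized_poly f(1) ..
  also have "\<bar>\<dots>\<bar> \<le> \<bar>x / ?a * hermite_normalized (Suc n) x\<bar> + \<bar>?b / ?a * hermite_normalized n x\<bar>"
    by (rule abs_triangle_ineq4)
  also have "\<bar>?b / ?a * hermite_normalized n x\<bar> \<le> 1 * \<bar>hermite_normalized n x\<bar>"
    unfolding abs_mult using ba pos by (intro mult_right_mono) (auto simp del: of_nat_Suc)
  finally show ?thesis using pos by (simp add: abs_mult del: of_nat_Suc)
qed

lemma hermite_normalized_subexponential:
  assumes "1 < (w::real)"
  obtains C where "0 \<le> C" "\<And>n. \<bar>hermite_normalized n x\<bar> \<le> C * w ^ n"
proof -
  \<comment> \<open>With this value, \<open>d * w + 1 = w\<^sup>2\<close>, so the bound \<open>C * w ^ n\<close> reproduces itself once \<open>\<bar>x\<bar> / sqrt n \<le> d\<close>.\<close>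
  define d where "d = w - 1 / w"
  have wpos: "0 < w" using assms by simp
  have d: "0 < d" using assms by (simp add: d_def field_simps) (metis mult_strict_mono' less_eq_real_def mult_1 zero_le_one)
  obtain N :: nat where N: "(\<bar>x\<bar> / d)\<^sup>2 < real N"
    using reals_Archimedean2 by blast
  have small: "\<bar>x\<bar> / sqrt (real (Suc (Suc n))) \<le> d" if "N \<le> n" for n
  proof -
    have "\<bar>x\<bar> / d = sqrt ((\<bar>x\<bar> / d)\<^sup>2)" using d by simp
    also have "\<dots> \<le> sqrt (real (Suc (Suc n)))" using N that by (intro real_sqrt_le_mono) simp
    finally show ?thesis using d by (simp add: field_simps)
  qed
  define C where "C = (\<Sum>n\<le>Suc N. \<bar>hermite_normalized n x\<bar>)"
  have C0: "0 \<le> C" by (simp add: C_def sum_nonneg)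
  have "\<bar>hermite_normalized n x\<bar> \<le> C * w ^ n" for n
  proof (induction n rule: less_induct)
    case (less n)
    show ?case
    proof (cases "n \<le> Suc N")
      case True
      have "\<bar>hermite_normalized n x\<bar> \<le> C"
        unfolding C_def by (rule member_le_sum) (use True in auto)
      also have "\<dots> \<le> C * w ^ n"
        using C0 assms by (simp add: mult_le_cancel_left1 one_le_power)
      finally show ?thesis .
    next
      case False
      then obtain k where k: "n = Suc (Suc k)" "N \<le> k"
        by (metis Suc_le_mono not_less_eq_eq Suc_le_D)
      have "\<bar>hermite_normalized n x\<bar> \<le> \<bar>x\<bar> / sqrt (real (Suc (Suc k))) * \<bar>hermite_normalized (Suc k) x\<bar> + \<bar>hermite_normalized k x\<bar>"
        unfolding k(1) by (rule hermite_normalized_recurrence_bound)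
      also have "\<dots> \<le> d * (C * w ^ Suc k) + C * w ^ k"
        using d by (intro add_mono mult_mono small k(2) less) (auto simp: k(1))
      also have "\<dots> = C * w ^ n"
        using wpos by (simp add: k(1) d_def field_simps)
      finally show ?thesis .
    qed
  qed
  with C0 show ?thesis using that by blast
qed

lemma summable_geometric_hermite_normalized:
  assumes "0 < s" "s < 1"
  shows "summable (\<lambda>n. s ^ n * \<bar>hermite_normalized n x\<bar>)"
proof -
  define w where "w = (1 + 1 / s) / 2"
  have w: "1 < w" "s * w < 1" "0 \<le> s * w" using assms by (auto simp: w_def field_simps)
  obtain C where C: "0 \<le> C" "\<And>n. \<bar>hermite_normalized n x\<bar> \<le> C * w ^ n"
    using hermite_normalized_subexponential[OF w(1)] by blast
  show ?thesis
  proof (rule summable_comparison_test')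
    show "summable (\<lambda>n. C * (s * w) ^ n)"
      using w by (intro summable_mult summable_geometric) auto
    show "norm (s ^ n * \<bar>hermite_normalized n x\<bar>) \<le> C * (s * w) ^ n" if "0 \<le> n" for n
      using mult_left_mono[OF C(2)[of n], of "s ^ n"] assms
      by (simp add: power_mult_distrib mult_ac)
  qed
qed

definition weighted_norm :: "real \<Rightarrow> (nat \<Rightarrow> complex) \<Rightarrow> real" where
  "weighted_norm q a = sqrt (\<Sum>n. (cmod (a n))\<^sup>2 / q ^ n)"

text \<open>The weights \<open>q ^ -n\<close> force geometric decay of the coefficients. All bounds on the Hermite space rest on
this estimate of a single coefficient by the norm.\<close>

lemma weighted_norm_coeff_bound:
  assumes q: "0 < q" and a: "summable (\<lambda>n. (cmod (a n))\<^sup>2 / q ^ n)"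
  shows "cmod (a n) \<le> weighted_norm q a * sqrt q ^ n"
proof -
  have "(\<Sum>k\<in>{n}. (cmod (a k))\<^sup>2 / q ^ k) \<le> (\<Sum>k. (cmod (a k))\<^sup>2 / q ^ k)"
    using q a by (intro sum_le_suminf) auto
  then have "sqrt ((cmod (a n))\<^sup>2 / q ^ n) \<le> weighted_norm q a"
    unfolding weighted_norm_def by (intro real_sqrt_le_mono) simp
  then show ?thesis using q by (simp add: real_sqrt_divide real_sqrt_power field_simps)
qed

lemma hermite_expansion_coeff_sum:
  assumes q: "0 < q" "q < 1" and a: "hermite_expansion q a f"
  shows "summable (\<lambda>n. cmod (a n))" "(\<Sum>n. cmod (a n)) \<le> weighted_norm q a / (1 - sqrt q)"
proof -
  have s: "0 < sqrt q" "sqrt q < 1" using q by auto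
  have b: "norm (cmod (a n)) \<le> weighted_norm q a * sqrt q ^ n" for n
    using weighted_norm_coeff_bound[OF q(1)] a by (simp add: hermite_expansion_def)
  have g: "summable (\<lambda>n. weighted_norm q a * sqrt q ^ n)"
    using s by (intro summable_mult summable_geometric) auto
  show 1: "summable (\<lambda>n. cmod (a n))"
    by (rule summable_comparison_test'[OF g b])
  have "(\<Sum>n. cmod (a n)) \<le> (\<Sum>n. weighted_norm q a * sqrt q ^ n)"
    using b by (intro suminf_le 1 g) simp
  also have "\<dots> = weighted_norm q a / (1 - sqrt q)"
    using s by (subst suminf_mult) (auto simp: suminf_geometric)
  finally show "(\<Sum>n. cmod (a n)) \<le> weighted_norm q a / (1 - sqrt q)" .
qed

lemma hermite_expansion_abs_summable:
  assumes q: "0 < q" "q < 1" and a: "hermite_expansion q a f"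
  shows "summable (\<lambda>n. cmod (a n) * \<bar>hermite_normalized n x\<bar>)"
    "cmod (f x) \<le> weighted_norm q a * (\<Sum>n. sqrt q ^ n * \<bar>hermite_normalized n x\<bar>)"
proof -
  have s: "0 < sqrt q" "sqrt q < 1" using q by auto
  have b: "cmod (a n) * \<bar>hermite_normalized n x\<bar> \<le> weighted_norm q a * (sqrt q ^ n * \<bar>hermite_normalized n x\<bar>)" for n
    using mult_right_mono[OF weighted_norm_coeff_bound[OF q(1), of a n], of "\<bar>hermite_normalized n x\<bar>"] a
    by (simp add: hermite_expansion_def mult_ac)
  note g0 = summable_geometric_hermite_normalized[OF s, of x]
  note g = summable_mult[OF g0, of "weighted_norm q a"]
  show 1: "summable (\<lambda>n. cmod (a n) * \<bar>hermite_normalized n x\<bar>)"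
    by (rule summable_comparison_test'[OF g]) (use b in simp)
  have "f x = (\<Sum>n. a n * of_real (hermite_normalized n x))"
    using a by (simp add: hermite_expansion_def sums_iff)
  also have "cmod \<dots> \<le> (\<Sum>n. cmod (a n * of_real (hermite_normalized n x)))"
    by (rule summable_norm) (use 1 in \<open>simp add: norm_mult\<close>)
  also have "\<dots> \<le> (\<Sum>n. weighted_norm q a * (sqrt q ^ n * \<bar>hermite_normalized n x\<bar>))"
    using 1 g b by (intro suminf_le) (auto simp: norm_mult)
  also have "\<dots> = weighted_norm q a * (\<Sum>n. sqrt q ^ n * \<bar>hermite_normalized n x\<bar>)"
    by (rule suminf_mult[OF g0])
  finally show "cmod (f x) \<le> weighted_norm q a * (\<Sum>n. sqrt q ^ n * \<bar>hermite_normalized n x\<bar>)" .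
qed

text \<open>A Hermite expansion may be integrated term by term against \<open>\<phi>\<close> times a Hermite polynomial over any Borel
set: every term contributes at most \<open>cmod (a n)\<close>, a summable sequence. For the whole line this recovers
the coefficients; for half lines with \<open>m = 0\<close> it bounds the Gaussian tails.\<close>

lemma hermite_expansion_integral:
  fixes m :: nat
  assumes q: "0 < q" "q < 1" and a: "hermite_expansion q a f" and A: "A \<in> sets borel"
  defines "w \<equiv> \<lambda>x. hermite_normalized m x * std_normal_density x"
  shows "set_integrable lborel A (\<lambda>x. f x * of_real (w x))"
    and "(\<lambda>n. a n * of_real (LINT x:A|lborel. hermite_normalized n x * w x)) sums
           (LINT x:A|lborel. f x * of_real (w x))"
    and "cmod (LINT x:A|lborel. f x * of_real (w x)) \<le> weighted_norm q a / (1 - sqrt q)"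
proof -
  define F where "F = (\<lambda>n x. a n * of_real (indicator A x * (hermite_normalized n x * w x)) :: complex)"
  have iw: "integrable lborel (\<lambda>x. hermite_normalized n x * w x)" for n
    unfolding w_def mult.assoc[symmetric] by (rule integrable_hermite_normalized_mult)
  have iA: "integrable lborel (\<lambda>x. indicator A x * (hermite_normalized n x * w x))" for n
    using integrable_mult_indicator[OF _ iw] A by simp
  have I: "integrable lborel (F n)" for n
    unfolding F_def using iA by (intro integrable_mult_right integrable_of_real)
  have pw: "summable (\<lambda>n. norm (F n x))" for x
  proof (rule summable_comparison_test')
    show "summable (\<lambda>n. (cmod (a n) * \<bar>hermite_normalized n x\<bar>) * \<bar>indicator A x * w x\<bar>)"
      by (rule summable_mult2, rule hermite_expansion_abs_summable[OF q a])
  qed (simp add: F_def norm_mult abs_mult mult_ac)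
  have nF: "(LBINT x. norm (F n x)) \<le> cmod (a n)" for n
  proof -
    have "(LBINT x. norm (F n x)) = cmod (a n) * (LBINT x. \<bar>indicator A x * (hermite_normalized n x * w x)\<bar>)"
      by (simp add: F_def norm_mult del: of_real_mult)
    also have "(LBINT x. \<bar>indicator A x * (hermite_normalized n x * w x)\<bar>) \<le> (LBINT x. \<bar>hermite_normalized n x * w x\<bar>)"
      by (intro integral_mono integrable_abs iA iw) (auto simp: indicator_def)
    also have "\<dots> \<le> 1"
      using integral_abs_hermite_normalized_mult_le_1[of n m] by (simp add: w_def mult.assoc)
    finally show ?thesis by (simp add: mult_left_mono mult_left_le)
  qed
  note sa = hermite_expansion_coeff_sum[OF q a]
  have sn: "summable (\<lambda>n. LBINT x. norm (F n x))"
    by (rule summable_comparison_test'[OF sa(1)]) (use nF in auto)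
  have AE: "AE x in lborel. summable (\<lambda>n. norm (F n x))" using pw by simp
  have sumF: "(\<Sum>n. F n x) = indicator A x *\<^sub>R (f x * of_real (w x))" for x
  proof -
    have "(\<lambda>n. (a n * of_real (hermite_normalized n x)) * of_real (indicator A x * w x)) sums
        (f x * of_real (indicator A x * w x))"
      by (rule sums_mult2) (use a in \<open>simp add: hermite_expansion_def\<close>)
    then have "(\<lambda>n. F n x) sums (indicator A x *\<^sub>R (f x * of_real (w x)))"
      by (simp add: F_def mult_ac scaleR_conv_of_real)
    then show ?thesis by (simp add: sums_iff)
  qed
  show "set_integrable lborel A (\<lambda>x. f x * of_real (w x))"
    using integrable_suminf[OF I AE sn] by (simp add: set_integrable_def sumF)
  have s: "(\<lambda>n. integral\<^sup>L lborel (F n)) sums (LINT x:A|lborel. f x * of_real (w x))"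
    using sums_integral[OF I AE sn] by (simp add: sumF set_lebesgue_integral_def)
  moreover have "integral\<^sup>L lborel (F n) = a n * of_real (LINT x:A|lborel. hermite_normalized n x * w x)" for n
    unfolding F_def by (subst integral_mult_right_zero, subst integral_of_real)
      (simp_all add: iA set_lebesgue_integral_def)
  ultimately show "(\<lambda>n. a n * of_real (LINT x:A|lborel. hermite_normalized n x * w x)) sums
           (LINT x:A|lborel. f x * of_real (w x))" by simp
  have le: "norm (integral\<^sup>L lborel (F n)) \<le> cmod (a n)" for n
    using integral_norm_bound[of lborel "F n"] nF[of n] by linarith
  have sn': "summable (\<lambda>n. norm (integral\<^sup>L lborel (F n)))"
    by (rule summable_comparison_test'[OF sa(1)]) (use le in auto)
  have "cmod (LINT x:A|lborel. f x * of_real (w x)) = norm (\<Sum>n. integral\<^sup>L lborel (F n))"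
    using s by (simp add: sums_iff)
  also have "\<dots> \<le> (\<Sum>n. norm (integral\<^sup>L lborel (F n)))"
    by (rule summable_norm[OF sn'])
  also have "\<dots> \<le> (\<Sum>n. cmod (a n))"
    by (intro suminf_le le sn' sa)
  finally show "cmod (LINT x:A|lborel. f x * of_real (w x)) \<le> weighted_norm q a / (1 - sqrt q)"
    using sa(2) by linarith
qed

lemma hermite_expansion_coeff_eq_integral:
  assumes q: "0 < q" "q < 1" and a: "hermite_expansion q a f"
  shows "a m = (LBINT x. f x * of_real (hermite_normalized m x * std_normal_density x))"
proof -
  have "(\<lambda>n. a n * of_real (if n = m then 1 else 0)) sums
      (LBINT x. f x * of_real (hermite_normalized m x * std_normal_density x))"
    using hermite_expansion_integral(2)[OF q a, of UNIV m]
    by (simp only: set_lebesgue_integral_def) (simp add: hermite_normalized_orthonormal flip: mult.assoc)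
  then have "(\<lambda>n. if n = m then a n else 0) sums
      (LBINT x. f x * of_real (hermite_normalized m x * std_normal_density x))"
    by (rule back_subst[of "\<lambda>s. s sums _"]) auto
  then show ?thesis
    using sums_If_finite[of "\<lambda>n. n = m" a] sums_unique2 by fastforce
qed

text \<open>Coefficients are determined by the function because orthonormality recovers them as integrals. This
identifies the definite description behind \<open>hermite_coeff\<close>, and with it the norm.\<close>

lemma hermite_coeff_eq:
  assumes q: "0 < q" "q < 1" and a: "hermite_expansion q a f"
  shows "hermite_coeff q f = a"
  unfolding hermite_coeff_def
proof (rule the_equality)
  show "hermite_expansion q a f" by (rule a)
next
  fix b assume b: "hermite_expansion q b f"
  show "b = a"
    using hermite_expansion_coeff_eq_integral[OF q a] hermite_expansion_coeff_eq_integral[OF q b]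
    by (auto simp: fun_eq_iff)
qed

lemma Hq_norm_eq_weighted_norm:
  assumes q: "0 < q" "q < 1" and a: "hermite_expansion q a f"
  shows "Hq_norm q f = weighted_norm q a"
proof -
  have "a n * cnj (a n) / of_real (q ^ n) = of_real ((cmod (a n))\<^sup>2 / q ^ n)" for n
    by (simp add: complex_norm_square[symmetric])
  then have "(\<Sum>n. a n * cnj (a n) / of_real (q ^ n)) = (\<Sum>n. of_real ((cmod (a n))\<^sup>2 / q ^ n))"
    by presburger
  moreover have "(\<Sum>n. of_real ((cmod (a n))\<^sup>2 / q ^ n)) = (of_real (\<Sum>n. (cmod (a n))\<^sup>2 / q ^ n) :: complex)"
    using a by (intro suminf_of_real[symmetric]) (simp add: hermite_expansion_def)
  ultimately show ?thesis
    by (simp only: Hq_norm_def Hq_inner_def hermite_coeff_eq[OF q a] weighted_norm_def Re_complex_of_real)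
qed

lemma hermite_expansion_cmult:
  assumes "hermite_expansion q a f"
  shows "hermite_expansion q (\<lambda>n. c * a n) (\<lambda>x. c * f x)"
  using assms unfolding hermite_expansion_def
  by (auto simp: norm_mult power_mult_distrib mult.assoc intro!: sums_mult
           dest: summable_mult[of _ "(cmod c)\<^sup>2"])

text \<open>The factor 2 is not optimal; an estimate of this quasi-triangle form is enough to compare consecutive
partial sums and to bound a resolvent.\<close>

lemma hermite_expansion_add:
  assumes q: "0 < q" and a: "hermite_expansion q a f" and b: "hermite_expansion q b g"
  shows "hermite_expansion q (\<lambda>n. a n + b n) (\<lambda>x. f x + g x)"
    and "weighted_norm q (\<lambda>n. a n + b n) \<le> 2 * (weighted_norm q a + weighted_norm q b)"
proof -
  let ?t = "\<lambda>a n. (cmod (a n))\<^sup>2 / q ^ n"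
  have sa: "summable (?t a)" and sb: "summable (?t b)"
    using a b by (auto simp: hermite_expansion_def)
  have le: "?t (\<lambda>n. a n + b n) n \<le> 2 * (?t a n + ?t b n)" for n
  proof -
    have "(cmod (a n + b n))\<^sup>2 \<le> (cmod (a n) + cmod (b n))\<^sup>2"
      by (intro power_mono norm_triangle_ineq) simp
    also have "\<dots> \<le> 2 * ((cmod (a n))\<^sup>2 + (cmod (b n))\<^sup>2)"
      using sum_squares_bound[of "cmod (a n)" "cmod (b n)"] by (simp add: power2_sum)
    finally have "(cmod (a n + b n))\<^sup>2 / q ^ n \<le> 2 * ((cmod (a n))\<^sup>2 + (cmod (b n))\<^sup>2) / q ^ n"
      using q by (intro divide_right_mono) auto
    then show ?thesis by (simp add: add_divide_distrib distrib_left)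
  qed
  have sab: "summable (\<lambda>n. 2 * (?t a n + ?t b n))"
    by (intro summable_mult summable_add sa sb)
  have s: "summable (?t (\<lambda>n. a n + b n))"
    by (rule summable_comparison_test'[OF sab]) (use le q in auto)
  show "hermite_expansion q (\<lambda>n. a n + b n) (\<lambda>x. f x + g x)"
    using a b s unfolding hermite_expansion_def by (auto simp: distrib_right intro!: sums_add)
  have nn: "0 \<le> suminf (?t a)" "0 \<le> suminf (?t b)"
    using q by (auto intro!: suminf_nonneg sa sb)
  then have wn: "0 \<le> weighted_norm q a" "0 \<le> weighted_norm q b"
    by (auto simp: weighted_norm_def)
  have "weighted_norm q (\<lambda>n. a n + b n) \<le> sqrt (2 * (suminf (?t a) + suminf (?t b)))"
    unfolding weighted_norm_def
    using suminf_le[OF le s sab] suminf_mult[OF summable_add[OF sa sb], of 2] suminf_add[OF sa sb]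
    by (intro real_sqrt_le_mono) simp
  also have "\<dots> \<le> sqrt ((2 * (weighted_norm q a + weighted_norm q b))\<^sup>2)"
  proof (rule real_sqrt_le_mono)
    have "(weighted_norm q a)\<^sup>2 = suminf (?t a)" "(weighted_norm q b)\<^sup>2 = suminf (?t b)"
      using nn by (simp_all add: weighted_norm_def)
    then show "2 * (suminf (?t a) + suminf (?t b)) \<le> (2 * (weighted_norm q a + weighted_norm q b))\<^sup>2"
      using nn mult_nonneg_nonneg[OF wn] by (simp add: power2_sum power_mult_distrib distrib_left)
  qed
  also have "\<dots> = 2 * (weighted_norm q a + weighted_norm q b)"
    using wn by simp
  finally show "weighted_norm q (\<lambda>n. a n + b n) \<le> 2 * (weighted_norm q a + weighted_norm q b)" .
qed

lemma hermite_expansion_const: "hermite_expansion q (\<lambda>n. if n = 0 then c else 0) (\<lambda>_. c)"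
proof -
  have "hermite_normalized 0 x = 1" for x by (simp add: hermite_normalized_poly)
  then have "(\<lambda>n. (if n = 0 then c else 0) * of_real (hermite_normalized n x)) =
      (\<lambda>n. if n = 0 then c else 0)" for x by auto
  moreover have "(\<lambda>n. if n = 0 then c else 0) sums c"
    using sums_If_finite[of "\<lambda>n::nat. n = 0" "\<lambda>_. c"] by simp
  moreover have "summable (\<lambda>n. (cmod (if n = 0 then c else 0))\<^sup>2 / q ^ n)"
    by (rule summable_finite[of "{0}"]) auto
  ultimately show ?thesis by (simp add: hermite_expansion_def)
qed

lemma weighted_norm_const: "weighted_norm q (\<lambda>n. if n = 0 then c else 0) = cmod c"
proof -
  have "(\<Sum>n. (cmod (if n = 0 then c else 0))\<^sup>2 / q ^ n) = (\<Sum>n\<in>{0}. (cmod (if n = 0 then c else 0))\<^sup>2 / q ^ n)"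
    by (rule suminf_finite) auto
  then show ?thesis by (simp add: weighted_norm_def)
qed

definition gauss_tail :: "(real \<Rightarrow> complex) \<Rightarrow> real \<Rightarrow> complex" where
  "gauss_tail f t = (LINT y:{t..}|lborel. f y * of_real (std_normal_density y))"

locale hermite_space =
  fixes q :: real
  assumes q: "0 < q" "q < 1"
begin

lemma Hq_expansion: "f \<in> Hq q \<Longrightarrow> hermite_expansion q (hermite_coeff q f) f"
  using hermite_coeff_eq[OF q] by (auto simp: Hq_def)

lemma Hq_norm_eq: "f \<in> Hq q \<Longrightarrow> Hq_norm q f = weighted_norm q (hermite_coeff q f)"
  by (rule Hq_norm_eq_weighted_norm[OF q Hq_expansion])

lemma Hq_add: "f \<in> Hq q \<Longrightarrow> g \<in> Hq q \<Longrightarrow> (\<lambda>x. f x + g x) \<in> Hq q"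
  using hermite_expansion_add(1)[OF q(1)] by (fastforce simp: Hq_def)

lemma Hq_cmult: "f \<in> Hq q \<Longrightarrow> (\<lambda>x. c * f x) \<in> Hq q"
  using hermite_expansion_cmult by (fastforce simp: Hq_def)

lemma Hq_const: "(\<lambda>_. c) \<in> Hq q"
  using hermite_expansion_const by (fastforce simp: Hq_def)

lemma Hq_norm_const: "Hq_norm q (\<lambda>_. c) = cmod c"
  using Hq_norm_eq_weighted_norm[OF q hermite_expansion_const] by (simp add: weighted_norm_const)

lemma Hq_norm_add_le:
  assumes "f \<in> Hq q" "g \<in> Hq q"
  shows "Hq_norm q (\<lambda>x. f x + g x) \<le> 2 * (Hq_norm q f + Hq_norm q g)"
proof -
  note fg = Hq_expansion[OF assms(1)] Hq_expansion[OF assms(2)]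
  note sum = hermite_expansion_add[OF q(1) fg]
  show ?thesis
    using sum(2) by (simp add: Hq_norm_eq_weighted_norm[OF q sum(1)] Hq_norm_eq assms)
qed

lemma Hq_norm_cmult:
  assumes "f \<in> Hq q"
  shows "Hq_norm q (\<lambda>x. c * f x) = cmod c * Hq_norm q f"
proof -
  have "summable (\<lambda>n. (cmod (hermite_coeff q f n))\<^sup>2 / q ^ n)"
    using Hq_expansion[OF assms] by (simp add: hermite_expansion_def)
  from suminf_mult[OF this, of "(cmod c)\<^sup>2"]
  have "weighted_norm q (\<lambda>n. c * hermite_coeff q f n) = cmod c * weighted_norm q (hermite_coeff q f)"
    by (simp add: weighted_norm_def norm_mult power_mult_distrib real_sqrt_mult)
  then show ?thesis
    using Hq_norm_eq_weighted_norm[OF q hermite_expansion_cmult[OF Hq_expansion[OF assms], of c]]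
    by (simp add: Hq_norm_eq assms)
qed

lemma Hq_diff: "f \<in> Hq q \<Longrightarrow> g \<in> Hq q \<Longrightarrow> (\<lambda>x. f x - g x) \<in> Hq q"
  using Hq_add[of f "\<lambda>x. (-1) * g x"] Hq_cmult[of g "-1"] by simp

lemma Hq_norm_diff_le:
  assumes "f \<in> Hq q" "g \<in> Hq q"
  shows "Hq_norm q (\<lambda>x. f x - g x) \<le> 2 * (Hq_norm q f + Hq_norm q g)"
  using Hq_norm_add_le[OF assms(1) Hq_cmult[OF assms(2), of "-1"]] Hq_norm_cmult[OF assms(2), of "-1"]
  by simp

lemma Hq_sum: "(\<And>m. m < N \<Longrightarrow> g m \<in> Hq q) \<Longrightarrow> (\<lambda>x. \<Sum>m<N. c m * g m x) \<in> Hq q" for N :: nat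
  by (induction N) (auto intro!: Hq_const Hq_add Hq_cmult)

text \<open>Linearity is only required on the space itself: the integrals behind \<open>gauss_tail\<close> are not additive on
arbitrary functions. The bound is a parameter because one bound has to serve all tails at once.\<close>

definition bounded_functional :: "real \<Rightarrow> ((real \<Rightarrow> complex) \<Rightarrow> complex) \<Rightarrow> bool" where
  "bounded_functional C L \<longleftrightarrow>
     (\<forall>f\<in>Hq q. \<forall>g\<in>Hq q. L (\<lambda>x. f x + g x) = L f + L g) \<and>
     (\<forall>c. \<forall>f\<in>Hq q. L (\<lambda>x. c * f x) = c * L f) \<and>
     (\<forall>f\<in>Hq q. cmod (L f) \<le> C * Hq_norm q f)"

lemma bounded_functional_eval:
  "bounded_functional (\<Sum>n. sqrt q ^ n * \<bar>hermite_normalized n x\<bar>) (\<lambda>f. f x)"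
  unfolding bounded_functional_def
  using hermite_expansion_abs_summable(2)[OF q Hq_expansion] by (auto simp: Hq_norm_eq mult.commute)

lemma Hq_gauss_integrable:
  assumes "f \<in> Hq q"
  shows "integrable lborel (\<lambda>y. f y * of_real (std_normal_density y))"
  using hermite_expansion_integral(1)[OF q Hq_expansion[OF assms], of UNIV 0]
  by (simp add: set_integrable_def hermite_normalized_poly)

lemma bounded_functional_gauss_tail: "bounded_functional (1 / (1 - sqrt q)) (\<lambda>f. gauss_tail f t)"
  unfolding bounded_functional_def
proof (intro conjI ballI allI)
  fix f g assume fg: "f \<in> Hq q" "g \<in> Hq q"
  have "set_integrable lborel {t..} (\<lambda>y. h y * of_real (std_normal_density y))" if "h \<in> Hq q" for h
    unfolding set_integrable_def by (intro integrable_mult_indicator Hq_gauss_integrable that) auto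
  then show "gauss_tail (\<lambda>x. f x + g x) t = gauss_tail f t + gauss_tail g t"
    unfolding gauss_tail_def distrib_right using fg by (intro set_integral_add(2)) auto
next
  fix c f assume "f \<in> Hq q"
  show "gauss_tail (\<lambda>x. c * f x) t = c * gauss_tail f t"
    by (simp add: gauss_tail_def mult.assoc)
next
  fix f assume f: "f \<in> Hq q"
  show "cmod (gauss_tail f t) \<le> 1 / (1 - sqrt q) * Hq_norm q f"
    using hermite_expansion_integral(3)[OF q Hq_expansion[OF f], of "{t..}" 0]
    by (simp add: gauss_tail_def hermite_normalized_poly Hq_norm_eq f)
qed

text \<open>Bounded functionals carry a series that converges in norm to a convergent series of numbers. Applied to
evaluations and tails, this extracts numerical expansions from the expansion of the eigenfunction.\<close>

lemma bounded_functional_series: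
  assumes L: "bounded_functional C L" and f: "f \<in> Hq q" and g: "\<And>m. g m \<in> Hq q"
    and lim: "(\<lambda>N. Hq_norm q (\<lambda>x. f x - (\<Sum>m<N. c m * g m x))) \<longlonglongrightarrow> 0"
  shows "(\<lambda>m. c m * L (g m)) sums L f"
proof -
  have add: "L (\<lambda>x. h x + k x) = L h + L k" and mul: "L (\<lambda>x. b * h x) = b * L h"
    and bd: "cmod (L h) \<le> C * Hq_norm q h" if "h \<in> Hq q" "k \<in> Hq q" for h k b
    using L that by (auto simp: bounded_functional_def)
  have sum: "L (\<lambda>x. \<Sum>m<N. c m * g m x) = (\<Sum>m<N. c m * L (g m))" for N
  proof (induction N)
    case 0
    show ?case using mul[OF Hq_const[of 0] Hq_const[of 0], of 0] by simp
  next
    case (Suc N)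
    show ?case
      using add[OF Hq_sum[of N g c] Hq_cmult[OF g, of "c N" N]] mul[OF g g] g Suc.IH by simp
  qed
  have diff: "L (\<lambda>x. f x - (\<Sum>m<N. c m * g m x)) = L f - (\<Sum>m<N. c m * L (g m))" for N
    using add[OF f Hq_cmult[OF Hq_sum[of N g c], of "-1"]] mul[OF Hq_sum[of N g c] f, of "-1"] g
    by (simp add: sum)
  have "(\<lambda>N. L f - (\<Sum>m<N. c m * L (g m))) \<longlonglongrightarrow> 0"
  proof (rule Lim_null_comparison)
    show "\<forall>\<^sub>F N in sequentially. norm (L f - (\<Sum>m<N. c m * L (g m))) \<le>
        C * Hq_norm q (\<lambda>x. f x - (\<Sum>m<N. c m * g m x))"
      using bd[OF Hq_diff[OF f Hq_sum[of _ g c]] f] g by (simp add: diff)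
    show "(\<lambda>N. C * Hq_norm q (\<lambda>x. f x - (\<Sum>m<N. c m * g m x))) \<longlonglongrightarrow> 0"
      using tendsto_mult_left[OF lim, of C] by simp
  qed
  then show ?thesis
    unfolding sums_def using tendsto_diff[OF tendsto_const[of "L f"]] by fastforce
qed

text \<open>Each term is the difference of two consecutive remainders, which tend to zero. At a fixed radius this gives
a geometric bound on \<open>Hq_norm q (g m)\<close>, and hence remainder estimates uniform in the functional.\<close>

lemma Hq_series_terms_bounded:
  assumes f: "f \<in> Hq q" and g: "\<And>m. g m \<in> Hq q"
    and lim: "(\<lambda>N. Hq_norm q (\<lambda>x. f x - (\<Sum>m<N. c m * g m x))) \<longlonglongrightarrow> 0"
  obtains B where "\<And>m. cmod (c m) * Hq_norm q (g m) \<le> B"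
proof -
  let ?r = "\<lambda>N x. f x - (\<Sum>m<N. c m * g m x)"
  have r: "?r N \<in> Hq q" for N using f g by (intro Hq_diff Hq_sum)
  obtain D where D: "\<And>N. norm (Hq_norm q (?r N)) \<le> D"
    using convergent_imp_Bseq[OF convergentI[OF lim]] by (auto simp: Bseq_def)
  have "cmod (c m) * Hq_norm q (g m) \<le> 2 * (D + D)" for m
  proof -
    have "cmod (c m) * Hq_norm q (g m) = Hq_norm q (\<lambda>x. ?r m x - ?r (Suc m) x)"
      by (simp add: Hq_norm_cmult g)
    also have "\<dots> \<le> 2 * (Hq_norm q (?r m) + Hq_norm q (?r (Suc m)))"
      by (intro Hq_norm_diff_le r)
    also have "\<dots> \<le> 2 * (D + D)"
      using D[of m] D[of "Suc m"] by (intro mult_left_mono add_mono) auto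
    finally show ?thesis .
  qed
  then show ?thesis using that by blast
qed

end

section \<open>Gaussian tails of polynomials\<close>

definition poly_tail :: "real poly \<Rightarrow> real \<Rightarrow> real" where
  "poly_tail p t = (LINT y:{t..}|lborel. poly p y * std_normal_density y)"

lemma gauss_tail_poly: "gauss_tail (\<lambda>x. of_real (poly p x)) t = of_real (poly_tail p t)"
  unfolding gauss_tail_def poly_tail_def set_integral_complex_of_real[symmetric] by simp

lemma has_real_derivative_poly_tail:
  "(poly_tail p has_real_derivative - (poly p t * std_normal_density t)) (at t)"
proof -
  let ?f = "\<lambda>y. poly p y * std_normal_density y"
  have tail: "poly_tail p s = (LBINT y=ereal s..\<infinity>. ?f y)" for s
    by (simp add: poly_tail_def interval_integral_to_infinity_eq set_integral_atLeast_eq_greaterThan measurable_poly_gauss)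
  have ii: "interval_lebesgue_integrable lborel a b ?f" for a b
    unfolding interval_lebesgue_integrable_def set_integrable_def
    by (auto intro!: integrable_mult_indicator integrable_poly_gauss simp del: real_scaleR_def)
  \<comment> \<open>Fixing the point 0 turns the lower limit into the upper limit of an integral over a bounded interval.\<close>
  have split: "poly_tail p s = poly_tail p 0 - (LBINT y=ereal 0..ereal s. ?f y)" for s
    using interval_integral_sum[OF ii, of 0 "ereal s" \<infinity>] by (simp add: tail zero_ereal_def)
  have "((\<lambda>u. LBINT y=ereal 0..ereal u. ?f y) has_vector_derivative ?f t) (at t within {- \<bar>t\<bar> - 1..\<bar>t\<bar> + 1})"
    by (rule interval_integral_FTC2)
       (auto intro!: continuous_at_imp_continuous_on isCont_poly_gauss)
  then have "((\<lambda>u. LBINT y=ereal 0..ereal u. ?f y) has_real_derivative ?f t) (at t)"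
    by (simp add: has_real_derivative_iff_has_vector_derivative at_within_Icc_at)
  then have "((\<lambda>s. poly_tail p 0 - (LBINT y=ereal 0..ereal s. ?f y)) has_real_derivative 0 - ?f t) (at t)"
    by (intro DERIV_diff) auto
  moreover have "(\<lambda>s. poly_tail p 0 - (LBINT y=ereal 0..ereal s. ?f y)) = poly_tail p"
    by (rule ext) (rule split[symmetric])
  ultimately show ?thesis by (simp only: diff_0)
qed

text \<open>The coefficient of \<open>u ^ j\<close> in \<open>u \<mapsto> \<integral>\<^sub>-\<^sub>u\<^sup>\<infinity> p \<phi>\<close>. For positive \<open>j\<close> the integral is a boundary term and the
coefficient only involves a derivative of \<open>p \<phi>\<close> at the origin.\<close>

definition tail_taylor_coeff :: "nat \<Rightarrow> real poly \<Rightarrow> real" where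
  "tail_taylor_coeff j p = (-1) ^ j / fact j * half_gauss_mean ((gauss_deriv ^^ j) p)"

lemma tail_taylor_coeff_Suc:
  "tail_taylor_coeff (Suc j) p = (-1) ^ j / fact (Suc j) * poly ((gauss_deriv ^^ j) p) 0 * std_normal_density 0"
  by (simp add: tail_taylor_coeff_def half_gauss_mean_gauss_deriv)

text \<open>Taylor's formula with Lagrange remainder: all derivatives are polynomials times \<open>\<phi>\<close>, hence bounded on
compact intervals.\<close>

lemma poly_tail_taylor:
  obtains B where "\<And>u. \<bar>u\<bar> \<le> r \<Longrightarrow>
    \<bar>poly_tail p (- u) - (\<Sum>j\<le>n. tail_taylor_coeff j p * u ^ j)\<bar> \<le> B * \<bar>u\<bar> ^ Suc n"
proof -
  define diff where "diff = (\<lambda>k u. case k of 0 \<Rightarrow> poly_tail p (- u)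
     | Suc j \<Rightarrow> (-1) ^ j * (poly ((gauss_deriv ^^ j) p) (- u) * std_normal_density (- u)))"
  have der: "DERIV (diff k) u :> diff (Suc k) u" for k u
  proof (cases k)
    case 0
    show ?thesis
      unfolding 0 diff_def
      using DERIV_chain'[OF DERIV_minus[OF DERIV_ident] has_real_derivative_poly_tail[of p], of u]
      by simp
  next
    case (Suc j)
    have "((\<lambda>u. poly ((gauss_deriv ^^ j) p) (- u) * std_normal_density (- u)) has_real_derivative
       poly (gauss_deriv ((gauss_deriv ^^ j) p)) (- u) * std_normal_density (- u) * (-1)) (at u)"
      using DERIV_chain'[OF DERIV_minus[OF DERIV_ident] has_real_derivative_poly_gauss[of "(gauss_deriv ^^ j) p"], of u]
      by (simp add: mult.commute)
    from DERIV_cmult[OF this, of "(-1) ^ j"] show ?thesis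
      unfolding Suc diff_def by simp
  qed
  have diff0: "diff k 0 / fact k = tail_taylor_coeff k p" for k
    by (cases k) (simp_all add: diff_def tail_taylor_coeff_Suc, simp add: tail_taylor_coeff_def half_gauss_mean_def poly_tail_def)
  have "continuous_on {- \<bar>r\<bar>..\<bar>r\<bar>} (diff (Suc n))"
    using der by (intro continuous_at_imp_continuous_on ballI DERIV_isCont) auto
  then have "bounded (diff (Suc n) ` {- \<bar>r\<bar>..\<bar>r\<bar>})"
    by (intro compact_imp_bounded compact_continuous_image) auto
  then obtain D where "\<forall>u\<in>{- \<bar>r\<bar>..\<bar>r\<bar>}. norm (diff (Suc n) u) \<le> D"
    unfolding bounded_iff by auto
  then have D: "\<bar>diff (Suc n) u\<bar> \<le> D" if "\<bar>u\<bar> \<le> \<bar>r\<bar>" for u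
    using that by (simp add: abs_le_iff)
  have "\<bar>poly_tail p (- u) - (\<Sum>j\<le>n. tail_taylor_coeff j p * u ^ j)\<bar> \<le> D / fact (Suc n) * \<bar>u\<bar> ^ Suc n"
    if u: "\<bar>u\<bar> \<le> r" for u
  proof -
    obtain t where t: "\<bar>t\<bar> \<le> \<bar>u\<bar>"
      "diff 0 u = (\<Sum>m<Suc n. diff m 0 / fact m * u ^ m) + diff (Suc n) t / fact (Suc n) * u ^ Suc n"
      using Maclaurin_bi_le[OF refl, of "Suc n" u diff] der by blast
    have "poly_tail p (- u) - (\<Sum>j\<le>n. tail_taylor_coeff j p * u ^ j) = diff (Suc n) t / fact (Suc n) * u ^ Suc n"
      using t(2) unfolding diff0 by (simp add: diff_def lessThan_Suc_atMost del: sum.lessThan_Suc fact_Suc power_Suc)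
    also have "\<bar>\<dots>\<bar> \<le> D / fact (Suc n) * \<bar>u\<bar> ^ Suc n"
      unfolding abs_mult abs_divide power_abs
      using D[of t] t(1) u by (intro mult_right_mono divide_right_mono) (auto simp del: fact_Suc intro!: divide_right_mono)
    finally show ?thesis .
  qed
  then show ?thesis using that by blast
qed

lemma iterated_vector_derivative_poly_gauss:
  "((\<lambda>F y. vector_derivative F (at y)) ^^ n) (\<lambda>y. of_real (poly p y) * of_real (std_normal_density y)) =
   (\<lambda>y. of_real (poly ((gauss_deriv ^^ n) p) y * std_normal_density y) :: complex)"
proof (induction n)
  case (Suc n)
  have "vector_derivative (\<lambda>y. of_real (poly ((gauss_deriv ^^ n) p) y * std_normal_density y) :: complex) (at y) =
      of_real (poly ((gauss_deriv ^^ Suc n) p) y * std_normal_density y)" for y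
  proof (rule vector_derivative_at)
    show "((\<lambda>y. of_real (poly ((gauss_deriv ^^ n) p) y * std_normal_density y) :: complex) has_vector_derivative
        of_real (poly ((gauss_deriv ^^ Suc n) p) y * std_normal_density y)) (at y)"
      using has_real_derivative_poly_gauss[of "(gauss_deriv ^^ n) p" y]
      by (intro has_vector_derivative_of_real) (simp add: has_real_derivative_iff_has_vector_derivative)
  qed
  then show ?case by (simp add: Suc.IH)
qed simp

lemma T_coeff_poly:
  "T_coeff j (\<lambda>x. of_real (poly p x)) x = of_real (tail_taylor_coeff j p * x ^ j)"
proof -
  have "(LINT y:{0..}|lborel. of_real (poly ((gauss_deriv ^^ j) p) y * std_normal_density y)) =
     (of_real (half_gauss_mean ((gauss_deriv ^^ j) p)) :: complex)"
    unfolding half_gauss_mean_def by (rule set_integral_complex_of_real)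
  then show ?thesis
    unfolding T_coeff_def iterated_vector_derivative_poly_gauss tail_taylor_coeff_def by simp
qed

lemma T_coeff_0: "T_coeff 0 h x = gauss_tail h 0"
  by (simp add: T_coeff_def gauss_tail_def)

lemma T_coeff_at_0: "0 < j \<Longrightarrow> T_coeff j h 0 = 0"
  by (simp add: T_coeff_def)

lemma T_op_eq_gauss_tail: "T_op \<rho> h x = gauss_tail h (- (\<rho> * x))"
  by (simp add: T_op_def gauss_tail_def)

text \<open>Dominated convergence: as \<open>t\<close> tends to 0, the indicators of \<open>{t..}\<close> converge at every point other than
the origin.\<close>

lemma (in hermite_space) continuous_gauss_tail:
  assumes "h \<in> Hq q"
  shows "isCont (gauss_tail h) 0"
  unfolding continuous_at_sequentially
proof (intro allI impI)
  fix t :: "nat \<Rightarrow> real" assume t: "t \<longlonglongrightarrow> 0"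
  let ?w = "\<lambda>y. h y * of_real (std_normal_density y)"
  note i = Hq_gauss_integrable[OF assms]
  have [measurable]: "?w \<in> borel_measurable lborel" using i by auto
  have "(\<lambda>n. LBINT y. indicator {t n..} y *\<^sub>R ?w y) \<longlonglongrightarrow> (LBINT y. indicator {0..} y *\<^sub>R ?w y)"
  proof (rule integral_dominated_convergence[where w = "\<lambda>y. norm (?w y)"])
    show "AE y in lborel. (\<lambda>n. indicator {t n..} y *\<^sub>R ?w y) \<longlonglongrightarrow> indicator {0..} y *\<^sub>R ?w y"
      using AE_lborel_singleton[of 0]
    proof eventually_elim
      case (elim y)
      have "\<forall>\<^sub>F n in sequentially. indicator {t n..} y = (indicator {0..} y :: real)"
      proof (cases "0 < y")
        case True
        from order_tendstoD(2)[OF t this] show ?thesis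
          by eventually_elim (use True in \<open>simp add: indicator_def\<close>)
      next
        case False
        then have "y < 0" using elim by simp
        from order_tendstoD(1)[OF t this] show ?thesis
          by eventually_elim (use \<open>y < 0\<close> in \<open>simp add: indicator_def\<close>)
      qed
      then show ?case by (intro tendsto_eventually) (auto elim: eventually_mono)
    qed
    show "integrable lborel (\<lambda>y. norm (?w y))" using i by (rule integrable_norm)
    show "AE y in lborel. norm (indicator {t n..} y *\<^sub>R ?w y) \<le> norm (?w y)" for n
      by (intro AE_I2) (simp add: indicator_def)
  qed auto
  then show "(gauss_tail h \<circ> t) \<longlonglongrightarrow> gauss_tail h 0"
    by (simp add: gauss_tail_def set_lebesgue_integral_def o_def)
qed

section \<open>Comparing coefficients at the origin\<close>

text \<open>A complex-valued monomial in a real variable, because Landau symbols compare functions with values in one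
field.\<close>

abbreviation rpow :: "nat \<Rightarrow> real \<Rightarrow> complex" where
  "rpow M \<equiv> \<lambda>\<rho>. of_real \<rho> ^ M"

lemma smallo_rpow_of_bound:
  fixes X :: "real \<Rightarrow> complex"
  assumes "0 < r" and X: "\<And>\<rho>. \<bar>\<rho>\<bar> \<le> r \<Longrightarrow> cmod (X \<rho>) \<le> D * \<bar>\<rho>\<bar> ^ Suc M"
  shows "X \<in> o[at 0](rpow M)"
proof (rule landau_o.big_small_trans)
  have "\<forall>\<^sub>F \<rho> in at 0. \<bar>\<rho>\<bar> < r"
    using assms(1) eventually_at_in_open[of "{-r<..<r}" 0] by (auto elim!: eventually_mono simp: abs_less_iff)
  then have "\<forall>\<^sub>F \<rho> in at 0. norm (X \<rho>) \<le> D * norm (rpow (Suc M) \<rho>)"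
    by eventually_elim (use X in \<open>simp add: norm_power norm_mult\<close>)
  then show "X \<in> O[at 0](rpow (Suc M))" by (rule bigoI)
  have "((\<lambda>\<rho>. rpow (Suc M) \<rho> / rpow M \<rho>) \<longlongrightarrow> 0) (at (0::real))"
  proof (rule Lim_transform_eventually)
    show "((\<lambda>\<rho>. of_real \<rho> :: complex) \<longlongrightarrow> 0) (at 0)"
      using tendsto_of_real[OF tendsto_ident_at[of 0 UNIV]] by simp
    show "\<forall>\<^sub>F \<rho> in at 0. of_real \<rho> = rpow (Suc M) \<rho> / rpow M \<rho>"
      using eventually_neq_at_within[of 0 0 UNIV] by eventually_elim simp
  qed
  then show "rpow (Suc M) \<in> o[at 0](rpow M)"
  proof (rule smalloI_tendsto)
    show "\<forall>\<^sub>F \<rho> in at 0. rpow M \<rho> \<noteq> 0"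
      using eventually_neq_at_within[of "0::real" 0 UNIV] by (rule eventually_mono) simp
  qed
qed

text \<open>Uniqueness of asymptotic expansions. If all coefficients below \<open>n\<close> vanish, division by \<open>\<rho> ^ n\<close> leaves
\<open>c n\<close> in the limit, while smallness makes the same limit zero.\<close>

lemma coefficients_zero_of_smallo:
  assumes F: "(\<lambda>\<rho>. \<Sum>m\<le>M. rpow m \<rho> * c m) \<in> o[at 0](rpow M)" and "n \<le> M"
  shows "c n = 0"
  using assms(2)
proof (induction n rule: less_induct)
  case (less n)
  let ?e = "\<lambda>\<rho>. \<Sum>m\<in>{n..M}. rpow (m - n) \<rho> * c m"
  \<comment> \<open>Divide by the lowest power that can still occur; the quotient has the limit \<open>c n\<close>.\<close>
  have low: "(\<Sum>m\<le>M. rpow m \<rho> * c m) = rpow n \<rho> * ?e \<rho>" for \<rho>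
  proof -
    have "(\<Sum>m\<le>M. rpow m \<rho> * c m) = (\<Sum>m\<in>{n..M}. rpow m \<rho> * c m)"
      by (rule sum.mono_neutral_right) (use less in auto)
    also have "\<dots> = rpow n \<rho> * ?e \<rho>"
      unfolding sum_distrib_left
    proof (rule sum.cong)
      fix m assume "m \<in> {n..M}"
      then have "rpow m \<rho> = rpow n \<rho> * rpow (m - n) \<rho>"
        using power_add[of "of_real \<rho> :: complex" n "m - n"] by simp
      then show "rpow m \<rho> * c m = rpow n \<rho> * (rpow (m - n) \<rho> * c m)" by simp
    qed simp
    finally show ?thesis .
  qed
  have "((\<lambda>\<rho>. (\<Sum>m\<le>M. rpow m \<rho> * c m) / rpow M \<rho> * rpow (M - n) \<rho>) \<longlongrightarrow> 0 * of_real 0 ^ (M - n)) (at 0)"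
    by (intro tendsto_mult smalloD_tendsto[OF F] tendsto_power tendsto_of_real tendsto_ident_at)
  moreover have "\<forall>\<^sub>F \<rho> in at 0. (\<Sum>m\<le>M. rpow m \<rho> * c m) / rpow M \<rho> * rpow (M - n) \<rho> = ?e \<rho>"
    using eventually_neq_at_within[of 0 0 UNIV]
  proof eventually_elim
    case (elim \<rho>)
    have "rpow M \<rho> = rpow n \<rho> * rpow (M - n) \<rho>" using power_add[of "of_real \<rho> :: complex" n "M - n"] less(2) by simp
    then show ?case unfolding low using elim by simp
  qed
  ultimately have "(?e \<longlongrightarrow> 0) (at 0)"
    using Lim_transform_eventually by fastforce
  moreover have "(?e \<longlongrightarrow> (\<Sum>m\<in>{n..M}. of_real 0 ^ (m - n) * c m)) (at 0)"
    by (intro tendsto_intros)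
  moreover have "(\<Sum>m\<in>{n..M}. of_real 0 ^ (m - n) * c m) = (\<Sum>m\<in>{n}. of_real 0 ^ (m - n) * c m)"
    by (rule sum.mono_neutral_right) (use less(2) in auto)
  ultimately show ?case
    using tendsto_unique[of "at 0" ?e] by fastforce
qed

text \<open>The constant depends on the coefficients only through \<open>B\<close>. This matters for the Gaussian tails
of the \<open>g m\<close>, which themselves vary with \<open>\<rho>\<close>.\<close>

lemma series_remainder_bound:
  fixes u :: "nat \<Rightarrow> complex"
  assumes r: "0 < r" and u: "\<And>m. cmod (u m) * r ^ m \<le> B"
    and s: "(\<lambda>m. of_real \<rho> ^ m * u m) sums U" and \<rho>: "\<bar>\<rho>\<bar> \<le> r / 2"
  shows "cmod (U - (\<Sum>m<n. of_real \<rho> ^ m * u m)) \<le> 2 * B / r ^ n * \<bar>\<rho>\<bar> ^ n"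
proof -
  define z where "z = \<bar>\<rho>\<bar> / r"
  have z: "0 \<le> z" "z \<le> 1 / 2" "z < 1" using r \<rho> by (auto simp: z_def field_simps)
  have B: "0 \<le> B" using order_trans[OF norm_ge_zero[of "u 0"], of B] u[of 0] by simp
  have b: "cmod (of_real \<rho> ^ m * u m) \<le> B * z ^ m" for m
  proof -
    have "cmod (of_real \<rho> ^ m * u m) = (cmod (u m) * r ^ m) * z ^ m"
      using r by (simp add: z_def norm_mult norm_power power_divide)
    also have "\<dots> \<le> B * z ^ m" using z by (intro mult_right_mono u) auto
    finally show ?thesis .
  qed
  have g: "(\<lambda>k. B * z ^ n * z ^ k) sums (B * z ^ n * (1 / (1 - z)))"
    using z by (intro sums_mult geometric_sums) auto
  have s': "(\<lambda>k. of_real \<rho> ^ (k + n) * u (k + n)) sums (U - (\<Sum>m<n. of_real \<rho> ^ m * u m))"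
    using sums_iff_shift[of "\<lambda>m. of_real \<rho> ^ m * u m" n] s by simp
  have b': "cmod (of_real \<rho> ^ (k + n) * u (k + n)) \<le> B * z ^ n * z ^ k" for k
    using b[of "k + n"] by (simp add: power_add mult_ac)
  have sn: "summable (\<lambda>k. cmod (of_real \<rho> ^ (k + n) * u (k + n)))"
    by (rule summable_comparison_test'[OF sums_summable[OF g]]) (use b' in simp)
  have "cmod (U - (\<Sum>m<n. of_real \<rho> ^ m * u m)) \<le> (\<Sum>k. cmod (of_real \<rho> ^ (k + n) * u (k + n)))"
    using summable_norm[OF sn] s' by (simp add: sums_iff)
  also have "\<dots> \<le> (\<Sum>k. B * z ^ n * z ^ k)"
    by (intro suminf_le sn sums_summable[OF g] b')
  also have "\<dots> = B * z ^ n * (1 / (1 - z))" using g by (simp add: sums_iff)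
  also have "\<dots> \<le> B * z ^ n * 2"
    using z B by (intro mult_left_mono) (auto simp: field_simps)
  finally show ?thesis by (simp add: z_def power_divide mult_ac)
qed

lemma power_series_remainder_smallo:
  fixes u :: "nat \<Rightarrow> complex"
  assumes R: "0 < R" and s: "\<And>\<rho>. \<bar>\<rho>\<bar> < R \<Longrightarrow> (\<lambda>m. of_real \<rho> ^ m * u m) sums U \<rho>"
  shows "(\<lambda>\<rho>. U \<rho> - (\<Sum>m\<le>M. rpow m \<rho> * u m)) \<in> o[at 0](rpow M)"
proof -
  \<comment> \<open>Convergence at the radius \<open>r\<close> bounds the coefficients; half of it leaves a geometric series of ratio at most 1/2.\<close>
  define r where "r = R / 2"
  have r: "0 < r" "\<bar>r\<bar> < R" using R by (auto simp: r_def)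
  have "Bseq (\<lambda>m. of_real r ^ m * u m)"
    using sums_summable[OF s[OF r(2)]] summable_imp_Bseq by blast
  then obtain B where B: "\<And>m. norm (of_real r ^ m * u m) \<le> B" by (auto simp: Bseq_def)
  have u: "cmod (u m) * r ^ m \<le> B" for m
    using B[of m] r by (simp add: norm_mult norm_power mult.commute)
  show ?thesis
  proof (rule smallo_rpow_of_bound)
    show "0 < r / 2" using r by simp
    fix \<rho> assume \<rho>: "\<bar>\<rho>\<bar> \<le> r / 2"
    then show "cmod (U \<rho> - (\<Sum>m\<le>M. rpow m \<rho> * u m)) \<le> 2 * B / r ^ Suc M * \<bar>\<rho>\<bar> ^ Suc M"
      using series_remainder_bound[OF r(1) u s \<rho>, of "Suc M"] r
      by (simp add: lessThan_Suc_atMost del: sum.lessThan_Suc power_Suc)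
  qed
qed

section \<open>The spectral radius at the origin\<close>

lemma gauss_tail_const: "gauss_tail (\<lambda>_. c) 0 = c / 2"
proof -
  have "gauss_tail (\<lambda>x. c * of_real (poly 1 x)) 0 = c * gauss_tail (\<lambda>x. of_real (poly 1 x)) 0"
    by (simp add: gauss_tail_def)
  moreover have "(LINT y:{0..}|lborel. std_normal_density y) = 1 / 2"
    using half_gauss_mean_1 by (simp add: half_gauss_mean_def)
  ultimately show ?thesis
    by (simp add: gauss_tail_poly[of 1, simplified] poly_tail_def)
qed

text \<open>Write \<open>T_op 0 h = l h\<close>, a constant function, with \<open>l 1 = 1/2\<close>. Applying \<open>l\<close> to \<open>l h - z h = k\<close> gives
\<open>l h = l k / (1/2 - z)\<close>, hence \<open>h = (l k / (1/2 - z) - k) / z\<close>. For \<open>z\<close> outside \<open>{0, 1/2}\<close> this is a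
bounded inverse because \<open>l\<close> is bounded. The value \<open>1/2\<close> is spectral because \<open>T_op 0 - 1/2\<close> kills the constants.
Boundedness of the spectrum is needed as well: otherwise the supremum would carry no information.\<close>

lemma (in hermite_space) spectral_radius_T_op_0: "Hq_spectral_radius q (T_op 0) = 1 / 2"
proof -
  let ?l = "\<lambda>h. gauss_tail h 0"
  let ?C = "1 / (1 - sqrt q)"
  have A: "T_op 0 h x = ?l h" for h x by (simp add: T_op_eq_gauss_tail)
  note bl = bounded_functional_gauss_tail[of 0, unfolded bounded_functional_def]
  have l_add: "?l (\<lambda>x. h x + k x) = ?l h + ?l k" if "h \<in> Hq q" "k \<in> Hq q" for h k using bl that by blast
  have l_mult: "?l (\<lambda>x. c * h x) = c * ?l h" if "h \<in> Hq q" for h c using bl that by blast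
  have l_bd: "cmod (?l h) \<le> ?C * Hq_norm q h" if "h \<in> Hq q" for h using bl that by blast
  have l_affine: "?l (\<lambda>x. c + d * h x) = c / 2 + d * ?l h" if "h \<in> Hq q" for c d h
    using l_add[OF Hq_const[of c] Hq_cmult[OF that, of d]] l_mult[OF that, of d] by (simp add: gauss_tail_const)
  have half: "1 / 2 \<in> Hq_spectrum q (T_op 0)"
  proof -
    have False if S: "Hq_bounded_operator q S"
      and inv: "\<forall>f\<in>Hq q. S (\<lambda>x. T_op 0 f x - 1 / 2 * f x) = f" for S
    proof -
      have "S (\<lambda>x. T_op 0 (\<lambda>_. 1) x - 1 / 2 * 1) = (\<lambda>_. 1)"
        using inv Hq_const[of 1] by fastforce
      moreover have "(\<lambda>x::real. T_op 0 (\<lambda>_. 1) x - 1 / 2 * 1) = (\<lambda>_. 0)"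
        by (simp add: A gauss_tail_const)
      moreover have "\<forall>c. \<forall>f\<in>Hq q. S (\<lambda>x. c * f x) = (\<lambda>x. c * S f x)"
        using S unfolding Hq_bounded_operator_def by simp
      from this[rule_format, OF Hq_const[of 0], of 0]
      have "S (\<lambda>x. 0) = (\<lambda>x. 0)" by simp
      ultimately have "(\<lambda>_::real. 0::complex) = (\<lambda>_. 1)" by metis
      then show False by (simp add: fun_eq_iff)
    qed
    then show ?thesis unfolding Hq_spectrum_def by blast
  qed
  have spec: "z = 0 \<or> z = 1 / 2" if z: "z \<in> Hq_spectrum q (T_op 0)" for z
  proof (rule ccontr)
    assume "\<not> (z = 0 \<or> z = 1 / 2)"
    then have z0: "z \<noteq> 0" "1 / 2 - z \<noteq> 0" by auto
    define c where "c = 1 / ((1 / 2 - z) * z)"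
    define S where "S = (\<lambda>h x. c * ?l h + (- 1 / z) * h x)"
    have c: "c * (1 / 2 - z) = 1 / z" using z0 by (simp add: c_def)
    have SH: "S h \<in> Hq q" if "h \<in> Hq q" for h
      unfolding S_def by (intro Hq_add Hq_const Hq_cmult that)
    have "Hq_bounded_operator q S"
      unfolding Hq_bounded_operator_def
    proof (intro conjI ballI allI)
      fix h k assume "h \<in> Hq q" "k \<in> Hq q"
      then show "S (\<lambda>x. h x + k x) = (\<lambda>x. S h x + S k x)"
        by (simp add: S_def l_add algebra_simps add_divide_distrib)
    next
      fix d h assume "h \<in> Hq q"
      then show "S (\<lambda>x. d * h x) = (\<lambda>x. d * S h x)"
        by (simp add: S_def l_mult algebra_simps)
    next
      have "Hq_norm q (S h) \<le> 2 * (cmod c * ?C + cmod (1 / z)) * Hq_norm q h" if h: "h \<in> Hq q" for h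
      proof -
        have "Hq_norm q (S h) \<le> 2 * (cmod (c * ?l h) + cmod (- 1 / z) * Hq_norm q h)"
          unfolding S_def
          using Hq_norm_add_le[OF Hq_const[of "c * ?l h"] Hq_cmult[OF h, of "- 1 / z"]]
          by (simp only: Hq_norm_const Hq_norm_cmult[OF h])
        also have "\<dots> \<le> 2 * (cmod c * (?C * Hq_norm q h) + cmod (- 1 / z) * Hq_norm q h)"
          unfolding norm_mult using l_bd[OF h] by (intro mult_left_mono add_mono) auto
        finally show ?thesis by (simp add: norm_divide algebra_simps)
      qed
      then show "\<exists>C. \<forall>h\<in>Hq q. Hq_norm q (S h) \<le> C * Hq_norm q h" by blast
    qed (use SH in auto)
    moreover have "S (\<lambda>x. T_op 0 h x - z * h x) = h" and "(\<lambda>x. T_op 0 (S h) x - z * S h x) = h"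
      if h: "h \<in> Hq q" for h
    proof -
      have "?l (\<lambda>x. T_op 0 h x - z * h x) = (1 / 2 - z) * ?l h"
        using l_affine[OF h, of "?l h" "- z"] by (simp add: A algebra_simps)
      then have "S (\<lambda>x. T_op 0 h x - z * h x) = (\<lambda>x. (c * (1 / 2 - z)) * ?l h + (- 1 / z) * (?l h - z * h x))"
        by (simp add: S_def A mult.assoc)
      also have "\<dots> = h" unfolding c using z0 by (simp add: field_simps)
      finally show "S (\<lambda>x. T_op 0 h x - z * h x) = h" .
      have "?l (S h) = (c * ?l h) / 2 + (- 1 / z) * ?l h"
        unfolding S_def by (rule l_affine[OF h])
      then have "T_op 0 (S h) x - z * S h x = (c * (1 / 2 - z)) * ?l h + (- 1 / z) * ?l h + h x" for x
        using z0 by (simp add: A) (simp add: S_def field_simps)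
      then show "(\<lambda>x. T_op 0 (S h) x - z * S h x) = h" unfolding c by simp
    qed
    ultimately have "z \<notin> Hq_spectrum q (T_op 0)" unfolding Hq_spectrum_def by blast
    with z show False by simp
  qed
  show ?thesis
    unfolding Hq_spectral_radius_def
  proof (rule cSup_eq_maximum)
    show "1 / 2 \<in> cmod ` Hq_spectrum q (T_op 0)"
      using half by (intro image_eqI[where x = "1 / 2"]) (simp_all add: norm_divide)
    fix r assume "r \<in> cmod ` Hq_spectrum q (T_op 0)"
    then obtain z where z: "z \<in> Hq_spectrum q (T_op 0)" "r = cmod z" by blast
    from spec[OF z(1)] have "cmod z \<le> 1 / 2"
    proof
      assume "z = 1 / 2"
      show ?thesis unfolding \<open>z = 1 / 2\<close> by (simp add: norm_divide)
    qed simp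
    then show "r \<le> 1 / 2" by (simp add: z)
  qed
qed

section \<open>The equations of each order\<close>

text \<open>The spectral radius is replaced by an arbitrary function \<open>lam\<close> with \<open>lam 0 = 1/2\<close>: the comparison of
coefficients only uses that it is an eigenvalue with a power series expansion.\<close>

locale eigen_expansion = hermite_space +
  fixes R :: real and f :: "real \<Rightarrow> real \<Rightarrow> complex" and lam :: "real \<Rightarrow> real"
    and K :: "nat \<Rightarrow> real" and g :: "nat \<Rightarrow> real \<Rightarrow> complex"
  assumes R: "0 < R"
    and lam_0: "lam 0 = 1 / 2"
    and f_mem: "\<And>\<rho>. \<bar>\<rho>\<bar> < R \<Longrightarrow> f \<rho> \<in> Hq q"
    and f_eigen: "\<And>\<rho>. \<bar>\<rho>\<bar> < R \<Longrightarrow> T_op \<rho> (f \<rho>) = (\<lambda>x. of_real (lam \<rho>) * f \<rho> x)"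
    and f_normalized: "\<And>\<rho>. \<bar>\<rho>\<bar> < R \<Longrightarrow> f \<rho> 0 = 1"
    and lam_expansion: "\<And>\<rho>. \<bar>\<rho>\<bar> < R \<Longrightarrow> (\<lambda>k. \<rho> ^ k * K k) sums lam \<rho>"
    and g_mem: "\<And>m. g m \<in> Hq q"
    and f_expansion: "\<And>\<rho>. \<bar>\<rho>\<bar> < R \<Longrightarrow>
      (\<lambda>N. Hq_norm q (\<lambda>x. f \<rho> x - (\<Sum>m<N. of_real (\<rho> ^ m) * g m x))) \<longlonglongrightarrow> 0"
begin

lemma f_sums: "\<bar>\<rho>\<bar> < R \<Longrightarrow> (\<lambda>m. of_real \<rho> ^ m * g m x) sums f \<rho> x"
  using bounded_functional_series[OF bounded_functional_eval f_mem g_mem f_expansion, of \<rho> x] by simp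

lemma tail_sums: "\<bar>\<rho>\<bar> < R \<Longrightarrow> (\<lambda>m. of_real \<rho> ^ m * gauss_tail (g m) t) sums gauss_tail (f \<rho>) t"
  using bounded_functional_series[OF bounded_functional_gauss_tail f_mem g_mem f_expansion, of \<rho> t] by simp

lemma g_at_0: "g m 0 = (if m = 0 then 1 else 0)"
proof -
  have "(\<lambda>m. of_real \<rho> ^ m * (g m 0 - (if m = 0 then 1 else 0))) sums 0" if "\<bar>\<rho>\<bar> < R" for \<rho>
  proof -
    have "(\<lambda>m. of_real \<rho> ^ m * (if m = 0 then 1 else 0)) sums (1::complex)"
      using sums_If_finite[of "\<lambda>m::nat. m = 0" "\<lambda>_. 1 :: complex"] by (simp add: if_distrib cong: if_cong)
    from sums_diff[OF f_sums[OF that, of 0] this] show ?thesis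
      by (simp add: f_normalized that right_diff_distrib)
  qed
  from power_series_remainder_smallo[OF R this, of m]
  have "(\<lambda>\<rho>. \<Sum>k\<le>m. rpow k \<rho> * (g k 0 - (if k = 0 then 1 else 0))) \<in> o[at 0](rpow m)" by simp
  from coefficients_zero_of_smallo[OF this, of m] show ?thesis by simp
qed

lemma lam_f_sums:
  assumes \<rho>: "\<bar>\<rho>\<bar> < R"
  shows "(\<lambda>n. of_real \<rho> ^ n * (\<Sum>k\<le>n. of_real (K k) * g (n - k) x)) sums (of_real (lam \<rho>) * f \<rho> x)"
proof -
  \<comment> \<open>A point strictly between \<open>\<bar>\<rho>\<bar>\<close> and the radius: convergence there gives absolute convergence at \<open>\<rho>\<close>, as the Cauchy product requires.\<close>
  define s where "s = (\<bar>\<rho>\<bar> + R) / 2"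
  have s: "\<bar>s\<bar> < R" "\<bar>\<rho>\<bar> < \<bar>s\<bar>" using \<rho> by (auto simp: s_def)
  have K: "(\<lambda>k. of_real \<sigma> ^ k * of_real (K k)) sums (of_real (lam \<sigma>) :: complex)" if "\<bar>\<sigma>\<bar> < R" for \<sigma>
    using sums_of_real[OF lam_expansion[OF that]] by simp
  have abs: "summable (\<lambda>m. norm (of_real \<rho> ^ m * u m))"
    if "summable (\<lambda>m. of_real s ^ m * u m)" for u :: "nat \<Rightarrow> complex"
    using powser_insidea[of u "of_real s" "of_real \<rho>"] that s by (simp add: mult.commute)
  have "(\<lambda>n. \<Sum>k\<le>n. (of_real \<rho> ^ k * of_real (K k)) * (of_real \<rho> ^ (n - k) * g (n - k) x)) sums
      ((\<Sum>k. of_real \<rho> ^ k * of_real (K k)) * (\<Sum>m. of_real \<rho> ^ m * g m x))"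
    by (intro Cauchy_product_sums abs sums_summable[OF K] sums_summable[OF f_sums] s)
  moreover have "(\<Sum>k\<le>n. (of_real \<rho> ^ k * of_real (K k)) * (of_real \<rho> ^ (n - k) * g (n - k) x)) =
      of_real \<rho> ^ n * (\<Sum>k\<le>n. of_real (K k) * g (n - k) x)" for n
    unfolding sum_distrib_left
  proof (rule sum.cong)
    fix k assume "k \<in> {..n}"
    then have "(of_real \<rho> :: complex) ^ n = of_real \<rho> ^ k * of_real \<rho> ^ (n - k)"
      using power_add[of "of_real \<rho> :: complex" k "n - k"] by simp
    then show "(of_real \<rho> ^ k * of_real (K k)) * (of_real \<rho> ^ (n - k) * g (n - k) x) =
        of_real \<rho> ^ n * (of_real (K k) * g (n - k) x)" by simp
  qed simp
  ultimately show ?thesis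
    using K[OF \<rho>] f_sums[OF \<rho>, of x] by (simp add: sums_iff)
qed

text \<open>Here the coefficients \<open>gauss_tail (g m) (- (\<rho> * x))\<close> depend on \<open>\<rho>\<close>, so this is not a power series; the
uniform bound on the tails makes the remainder small all the same.\<close>

lemma tail_expansion:
  "(\<lambda>\<rho>. gauss_tail (f \<rho>) (- (\<rho> * x)) - (\<Sum>m\<le>M. rpow m \<rho> * gauss_tail (g m) (- (\<rho> * x)))) \<in> o[at 0](rpow M)"
proof -
  define r where "r = R / 2"
  have r: "0 < r" "\<bar>r\<bar> < R" using R by (auto simp: r_def)
  obtain B where B: "\<And>m. cmod (of_real (r ^ m)) * Hq_norm q (g m) \<le> B"
    using Hq_series_terms_bounded[OF f_mem g_mem f_expansion, of r] r by blast
  let ?C = "1 / (1 - sqrt q)"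
  have u: "cmod (gauss_tail (g m) t) * r ^ m \<le> ?C * B" for m t
  proof -
    have "cmod (gauss_tail (g m) t) * r ^ m \<le> (?C * Hq_norm q (g m)) * r ^ m"
      using bounded_functional_gauss_tail[of t] g_mem r
      by (intro mult_right_mono) (auto simp: bounded_functional_def)
    also have "\<dots> = ?C * (cmod (of_real (r ^ m)) * Hq_norm q (g m))"
      using r by (simp add: norm_power)
    also have "\<dots> \<le> ?C * B" using B q by (intro mult_left_mono) auto
    finally show ?thesis .
  qed
  show ?thesis
  proof (rule smallo_rpow_of_bound)
    show "0 < r / 2" using r by simp
    fix \<rho> assume \<rho>: "\<bar>\<rho>\<bar> \<le> r / 2"
    show "cmod (gauss_tail (f \<rho>) (- (\<rho> * x)) - (\<Sum>m\<le>M. rpow m \<rho> * gauss_tail (g m) (- (\<rho> * x)))) \<le>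
       2 * (?C * B) / r ^ Suc M * \<bar>\<rho>\<bar> ^ Suc M"
      using series_remainder_bound[OF r(1) u tail_sums \<rho>, of "- (\<rho> * x)" "Suc M"] r \<rho>
      by (simp only: lessThan_Suc_atMost)
  qed
qed

text \<open>The coefficient of \<open>\<rho> ^ M\<close> in the eigenvalue equation. The tail of \<open>g m\<close> carries the factor \<open>\<rho> ^ m\<close>, so
it has to be expanded only up to order \<open>M - m\<close>: by Taylor's formula for the polynomials below \<open>M\<close>, and by
mere continuity for \<open>g M\<close>.\<close>

lemma order_equation:
  assumes poly: "\<And>m. m < M \<Longrightarrow> \<exists>p. g m = (\<lambda>x. of_real (poly p x))"
  shows "(\<Sum>k\<le>M. of_real (K k) * g (M - k) x) = (\<Sum>j\<le>M. T_coeff j (g (M - j)) x)"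
proof -
  let ?t = "\<lambda>m \<rho>. gauss_tail (g m) (- (\<rho> * x))"
  let ?d = "\<lambda>j m. T_coeff j (g m) x"
  have summand: "(\<lambda>\<rho>. rpow m \<rho> * (?t m \<rho> - (\<Sum>j\<le>M - m. rpow j \<rho> * ?d j m))) \<in> o[at 0](rpow M)" if m: "m \<le> M" for m
  proof -
    have "(\<lambda>\<rho>. ?t m \<rho> - (\<Sum>j\<le>M - m. rpow j \<rho> * ?d j m)) \<in> o[at 0](rpow (M - m))"
    proof (cases "m = M")
      case True
      have "isCont (\<lambda>\<rho>. ?t m \<rho>) 0"
        by (rule isCont_o2[where g = "gauss_tail (g m)"]) (auto intro!: continuous_intros continuous_gauss_tail g_mem)
      then have "((\<lambda>\<rho>. ?t m \<rho> - gauss_tail (g m) 0) \<longlongrightarrow> 0) (at 0)"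
        by (simp add: isCont_def LIM_zero)
      then show ?thesis using True by (simp add: T_coeff_0 smalloI_tendsto)
    next
      case False
      then obtain p where p: "g m = (\<lambda>x. of_real (poly p x))" using poly m by fastforce
      obtain B where B: "\<And>u. \<bar>u\<bar> \<le> \<bar>x\<bar> \<Longrightarrow>
          \<bar>poly_tail p (- u) - (\<Sum>j\<le>M - m. tail_taylor_coeff j p * u ^ j)\<bar> \<le> B * \<bar>u\<bar> ^ Suc (M - m)"
        using poly_tail_taylor[of "\<bar>x\<bar>" p "M - m"] by blast
      show ?thesis
      proof (rule smallo_rpow_of_bound)
        fix \<rho> :: real assume "\<bar>\<rho>\<bar> \<le> 1"
        then have "\<bar>\<rho> * x\<bar> \<le> \<bar>x\<bar>" by (simp add: abs_mult mult_left_le_one_le)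
        note b = B[OF this]
        have "?t m \<rho> - (\<Sum>j\<le>M - m. rpow j \<rho> * ?d j m) =
           of_real (poly_tail p (- (\<rho> * x)) - (\<Sum>j\<le>M - m. tail_taylor_coeff j p * (\<rho> * x) ^ j))"
          by (simp add: p T_coeff_poly gauss_tail_poly power_mult_distrib mult_ac)
        then show "cmod (?t m \<rho> - (\<Sum>j\<le>M - m. rpow j \<rho> * ?d j m)) \<le> B * \<bar>x\<bar> ^ Suc (M - m) * \<bar>\<rho>\<bar> ^ Suc (M - m)"
          using b by (simp only: norm_of_real) (simp add: abs_mult power_mult_distrib mult_ac)
      qed simp
    qed
    then have "(\<lambda>\<rho>. rpow m \<rho> * (?t m \<rho> - (\<Sum>j\<le>M - m. rpow j \<rho> * ?d j m))) \<in> o[at 0](\<lambda>\<rho>. rpow m \<rho> * rpow (M - m) \<rho>)"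
      by (rule landau_o.small.mult_left)
    moreover have "(\<lambda>\<rho>. rpow m \<rho> * rpow (M - m) \<rho>) = rpow M"
      using m by (simp add: fun_eq_iff power_add[symmetric])
    ultimately show ?thesis by simp
  qed
  have reindex: "(\<Sum>m\<le>M. rpow m \<rho> * (\<Sum>j\<le>M - m. rpow j \<rho> * ?d j m)) =
      (\<Sum>n\<le>M. rpow n \<rho> * (\<Sum>j\<le>n. ?d j (n - j)))" for \<rho>
  proof -
    have "(\<Sum>m\<le>M. rpow m \<rho> * (\<Sum>j\<le>M - m. rpow j \<rho> * ?d j m)) =
        (\<Sum>(m, j)\<in>(SIGMA m:{..M}. {..M - m}). rpow m \<rho> * (rpow j \<rho> * ?d j m))"
      by (simp add: sum_distrib_left sum.Sigma)
    also have "(SIGMA m:{..M}. {..M - m}) = prod.swap ` {(j, m). j + m \<le> M}"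
      by (auto simp: image_iff)
    also have "(\<Sum>(m, j)\<in>\<dots>. rpow m \<rho> * (rpow j \<rho> * ?d j m)) = 
        (\<Sum>(j, m)\<in>{(j, m). j + m \<le> M}. rpow m \<rho> * (rpow j \<rho> * ?d j m))"
      by (subst sum.reindex) (auto intro!: sum.cong)
    also have "\<dots> = (\<Sum>n\<le>M. \<Sum>j\<le>n. rpow (n - j) \<rho> * (rpow j \<rho> * ?d j (n - j)))"
      by (rule sum.triangle_reindex_eq)
    also have "\<dots> = (\<Sum>n\<le>M. rpow n \<rho> * (\<Sum>j\<le>n. ?d j (n - j)))"
      unfolding sum_distrib_left
    proof (intro sum.cong refl)
      fix n j :: nat assume "j \<in> {..n}"
      then have "rpow n \<rho> = rpow (n - j) \<rho> * rpow j \<rho>"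
        using power_add[of "of_real \<rho> :: complex" "n - j" j] by simp
      then show "rpow (n - j) \<rho> * (rpow j \<rho> * ?d j (n - j)) = rpow n \<rho> * ?d j (n - j)" by simp
    qed
    finally show ?thesis .
  qed
  have "(\<lambda>\<rho>. \<Sum>m\<le>M. rpow m \<rho> * (?t m \<rho> - (\<Sum>j\<le>M - m. rpow j \<rho> * ?d j m))) \<in> o[at 0](rpow M)"
    by (rule big_sum_in_smallo) (use summand in auto)
  from sum_in_smallo(1)[OF tail_expansion[of x M] this]
  have rhs: "(\<lambda>\<rho>. gauss_tail (f \<rho>) (- (\<rho> * x)) - (\<Sum>n\<le>M. rpow n \<rho> * (\<Sum>j\<le>n. ?d j (n - j)))) \<in> o[at 0](rpow M)"
    by (simp add: right_diff_distrib sum_subtractf reindex)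
  have lhs: "(\<lambda>\<rho>. of_real (lam \<rho>) * f \<rho> x - (\<Sum>n\<le>M. rpow n \<rho> * (\<Sum>k\<le>n. of_real (K k) * g (n - k) x))) \<in> o[at 0](rpow M)"
    by (rule power_series_remainder_smallo[OF R lam_f_sums])
  have "(\<lambda>\<rho>. \<Sum>n\<le>M. rpow n \<rho> * ((\<Sum>k\<le>n. of_real (K k) * g (n - k) x) - (\<Sum>j\<le>n. ?d j (n - j)))) \<in> o[at 0](rpow M)"
  proof (rule landau_o.small.in_cong[THEN iffD1, OF _ sum_in_smallo(2)[OF rhs lhs]])
    have "\<forall>\<^sub>F \<rho> in at 0. \<bar>\<rho>\<bar> < R"
      using R eventually_at_in_open[of "{-R<..<R}" 0] by (auto elim!: eventually_mono simp: abs_less_iff)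
    then show "\<forall>\<^sub>F \<rho> in at 0. gauss_tail (f \<rho>) (- (\<rho> * x)) - (\<Sum>n\<le>M. rpow n \<rho> * (\<Sum>j\<le>n. ?d j (n - j))) -
         (of_real (lam \<rho>) * f \<rho> x - (\<Sum>n\<le>M. rpow n \<rho> * (\<Sum>k\<le>n. of_real (K k) * g (n - k) x))) =
         (\<Sum>n\<le>M. rpow n \<rho> * ((\<Sum>k\<le>n. of_real (K k) * g (n - k) x) - (\<Sum>j\<le>n. ?d j (n - j))))"
    proof eventually_elim
      case (elim \<rho>)
      from fun_cong[OF f_eigen[OF this], of x] have "gauss_tail (f \<rho>) (- (\<rho> * x)) = of_real (lam \<rho>) * f \<rho> x"
        by (simp add: T_op_eq_gauss_tail)
      then show ?case by (simp add: right_diff_distrib sum_subtractf)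
    qed
  qed
  from coefficients_zero_of_smallo[OF this, of M] show ?thesis by simp
qed

lemma K_0: "K 0 = 1 / 2"
proof -
  have "(\<lambda>k. K k * 0 ^ k) sums lam 0"
    using lam_expansion[of 0] R by (simp add: mult.commute)
  from sums_unique2[OF this powser_sums_zero] show ?thesis using lam_0 by simp
qed

lemma g_0: "g 0 = (\<lambda>x. 1)"
proof
  fix x
  have "of_real (K 0) * g 0 y = gauss_tail (g 0) 0" for y
    using order_equation[of 0 y] by (simp add: T_coeff_0)
  from this[of x] this[of 0] show "g 0 x = 1" by (simp add: K_0 g_at_0)
qed

text \<open>At \<open>x = 0\<close> each side of the order equation collapses to one term, since \<open>g m 0 = 0\<close> for positive \<open>m\<close>
and \<open>T_coeff j\<close> has the factor \<open>x ^ j\<close>.\<close>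

lemma K_eq_of_poly:
  assumes poly: "\<And>m. m < M \<Longrightarrow> \<exists>p. g m = (\<lambda>x. of_real (poly p x))"
  shows "T_coeff 0 (g M) x = of_real (K M)"
proof -
  have "(\<Sum>k\<le>M. of_real (K k) * g (M - k) 0) = (\<Sum>k\<in>{M}. of_real (K k) * g (M - k) 0)"
    by (rule sum.mono_neutral_right) (auto simp: g_at_0)
  moreover have "(\<Sum>j\<le>M. T_coeff j (g (M - j)) 0) = (\<Sum>j\<in>{0}. T_coeff j (g (M - j)) 0)"
    by (rule sum.mono_neutral_right) (auto simp: T_coeff_at_0)
  ultimately show ?thesis
    using order_equation[OF poly, of M 0] by (simp add: g_at_0 T_coeff_0)
qed

text \<open>Solve the order equation for \<open>g M\<close>: the summand \<open>K M * g 0 = K M\<close> on the left cancels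
\<open>T_coeff 0 (g M)\<close> on the right, the only other place where \<open>g M\<close> occurs.\<close>

lemma recursion_of_poly:
  assumes poly: "\<And>m. m < M \<Longrightarrow> \<exists>p. g m = (\<lambda>x. of_real (poly p x))" and "1 \<le> M"
  shows "g M x = 1 / of_real (K 0) *
      ((\<Sum>j=1..M. T_coeff j (g (M - j)) x) - (\<Sum>j=1..M - 1. T_coeff 0 (g j) x * g (M - j) x))"
proof -
  have sum: "(\<Sum>j=1..M - 1. T_coeff 0 (g j) x * g (M - j) x) = (\<Sum>j=1..M - 1. of_real (K j) * g (M - j) x)"
    by (intro sum.cong refl arg_cong2[of _ _ _ _ "(*)"] K_eq_of_poly poly) auto
  have "{..M} = {0, M} \<union> {1..M - 1}" using assms(2) by auto
  then have "(\<Sum>k\<le>M. of_real (K k) * g (M - k) x) =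
      (\<Sum>k\<in>{0, M}. of_real (K k) * g (M - k) x) + (\<Sum>j=1..M - 1. of_real (K j) * g (M - j) x)"
    by (simp only:) (rule sum.union_disjoint, use assms(2) in auto)
  also have "(\<Sum>k\<in>{0, M}. of_real (K k) * g (M - k) x) = of_real (K 0) * g M x + of_real (K M)"
    using assms(2) by (simp add: g_0)
  finally have lhs: "(\<Sum>k\<le>M. of_real (K k) * g (M - k) x) =
      of_real (K 0) * g M x + of_real (K M) + (\<Sum>j=1..M - 1. of_real (K j) * g (M - j) x)" .
  have "(\<Sum>j\<le>M. T_coeff j (g (M - j)) x) = T_coeff 0 (g M) x + (\<Sum>j=1..M. T_coeff j (g (M - j)) x)"
    by (simp add: atMost_atLeast0 sum.atLeast_Suc_atMost)
  then have rhs: "(\<Sum>j\<le>M. T_coeff j (g (M - j)) x) = of_real (K M) + (\<Sum>j=1..M. T_coeff j (g (M - j)) x)"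
    using K_eq_of_poly[OF poly] by simp
  show ?thesis
    using order_equation[OF poly, of M x] unfolding lhs rhs sum by (simp add: K_0 field_simps)
qed

lemma g_poly_step:
  assumes P: "\<And>m. m < M \<Longrightarrow> g m = (\<lambda>x. of_real (poly (P m) x))" and "1 \<le> M"
  shows "g M = (\<lambda>x. of_real (poly (smult 2 ((\<Sum>j=1..M. monom (tail_taylor_coeff j (P (M - j))) j) -
       (\<Sum>j=1..M - 1. smult (half_gauss_mean (P j)) (P (M - j))))) x))"
proof
  fix x
  have T0: "T_coeff 0 (\<lambda>x. of_real (poly p x)) y = of_real (half_gauss_mean p)" for p y
    by (simp add: T_coeff_poly tail_taylor_coeff_def)
  have 1: "(\<Sum>j=1..M. T_coeff j (g (M - j)) x) = of_real (\<Sum>j=1..M. tail_taylor_coeff j (P (M - j)) * x ^ j)"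
    unfolding of_real_sum by (rule sum.cong) (auto simp: P T_coeff_poly)
  have 2: "(\<Sum>j=1..M - 1. T_coeff 0 (g j) x * g (M - j) x) = of_real (\<Sum>j=1..M - 1. half_gauss_mean (P j) * poly (P (M - j)) x)"
    unfolding of_real_sum by (rule sum.cong) (auto simp: P T0)
  have "g M x = 1 / of_real (K 0) *
      ((\<Sum>j=1..M. T_coeff j (g (M - j)) x) - (\<Sum>j=1..M - 1. T_coeff 0 (g j) x * g (M - j) x))"
    using P by (intro recursion_of_poly assms(2)) blast
  then show "g M x = of_real (poly (smult 2 ((\<Sum>j=1..M. monom (tail_taylor_coeff j (P (M - j))) j) -
       (\<Sum>j=1..M - 1. smult (half_gauss_mean (P j)) (P (M - j))))) x)"
    unfolding 1 2 by (simp add: K_0 poly_sum poly_monom)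
qed

lemma g_poly: "\<exists>p. degree p \<le> m \<and> g m = (\<lambda>x. of_real (poly p x))"
proof (induction m rule: less_induct)
  case (less m)
  show ?case
  proof (cases "m = 0")
    case True
    then show ?thesis by (intro exI[of _ 1]) (simp add: g_0)
  next
    case False
    obtain P where P: "\<And>k. k < m \<Longrightarrow> degree (P k) \<le> k \<and> g k = (\<lambda>x. of_real (poly (P k) x))"
      using less by metis
    have "degree (smult 2 ((\<Sum>j=1..m. monom (tail_taylor_coeff j (P (m - j))) j) -
       (\<Sum>j=1..m - 1. smult (half_gauss_mean (P j)) (P (m - j))))) \<le> m"
    proof (rule order.trans[OF degree_smult_le], intro degree_diff_le degree_sum_le)
      show "degree (monom (tail_taylor_coeff j (P (m - j))) j) \<le> m" if "j \<in> {1..m}" for j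
        by (rule order.trans[OF degree_monom_le]) (use that in simp)
      show "degree (smult (half_gauss_mean (P j)) (P (m - j))) \<le> m" if j: "j \<in> {1..m - 1}" for j
      proof (rule order.trans[OF degree_smult_le])
        show "degree (P (m - j)) \<le> m" using P[of "m - j"] j by fastforce
      qed
    qed auto
    moreover have "g m = (\<lambda>x. of_real (poly (smult 2 ((\<Sum>j=1..m. monom (tail_taylor_coeff j (P (m - j))) j) -
       (\<Sum>j=1..m - 1. smult (half_gauss_mean (P j)) (P (m - j))))) x))"
      by (rule g_poly_step) (use P False in auto)
    ultimately show ?thesis by blast
  qed
qed

lemma K_eq: "T_coeff 0 (g m) x = of_real (K m)"
  using K_eq_of_poly g_poly by meson

lemma recursion: "1 \<le> M \<Longrightarrow> g M x = 1 / of_real (K 0) *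
      ((\<Sum>j=1..M. T_coeff j (g (M - j)) x) - (\<Sum>j=1..M - 1. T_coeff 0 (g j) x * g (M - j) x))"
  using recursion_of_poly g_poly by meson

text \<open>The recursion for the real polynomials behind the \<open>g m\<close>, in a form that can be evaluated on coefficient
lists.\<close>

lemma poly_recursion:
  obtains P where "\<And>m. degree (P m) \<le> m" "\<And>m. g m = (\<lambda>x. of_real (poly (P m) x))"
    "\<And>m. K m = half_gauss_mean (P m)" "P 0 = 1"
    "\<And>M. 1 \<le> M \<Longrightarrow> P M = smult 2 ((\<Sum>j=1..M. monom (tail_taylor_coeff j (P (M - j))) j) -
       (\<Sum>j=1..M - 1. smult (K j) (P (M - j))))"
proof -
  obtain P where P: "\<And>m. degree (P m) \<le> m" "\<And>m. g m = (\<lambda>x. of_real (poly (P m) x))"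
    using g_poly by metis
  have inj: "p = r" if "(\<lambda>x. of_real (poly p x) :: complex) = (\<lambda>x. of_real (poly r x))" for p r :: "real poly"
    using that by (simp add: fun_eq_iff flip: poly_eq_poly_eq_iff)
  have K: "K m = half_gauss_mean (P m)" for m
  proof -
    have "of_real (K m) = (of_real (half_gauss_mean (P m)) :: complex)"
      using K_eq[of m 0] by (simp add: P(2) T_coeff_poly tail_taylor_coeff_def)
    then show ?thesis by (simp only: of_real_eq_iff)
  qed
  show ?thesis
  proof (rule that[of P])
    show "degree (P m) \<le> m" for m by (rule P(1))
    show "g m = (\<lambda>x. of_real (poly (P m) x))" for m by (rule P(2))
    show "K m = half_gauss_mean (P m)" for m by (rule K)
    show "P 0 = 1" by (rule inj) (use g_0 P(2)[of 0] in simp)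
    show "P M = smult 2 ((\<Sum>j=1..M. monom (tail_taylor_coeff j (P (M - j))) j) -
       (\<Sum>j=1..M - 1. smult (K j) (P (M - j))))" if "1 \<le> M" for M
      unfolding K by (rule inj) (use g_poly_step[of M P] P(2) that in metis)
  qed
qed

end

section \<open>The first coefficients\<close>

lemma gauss_deriv_add: "gauss_deriv (p + r) = gauss_deriv p + gauss_deriv r"
  by (simp add: gauss_deriv_def pderiv_add)

lemma gauss_deriv_smult: "gauss_deriv (smult c p) = smult c (gauss_deriv p)"
  by (simp add: gauss_deriv_def pderiv_smult smult_diff_right)

text \<open>The numbers \<open>(p \<phi>)\<^sup>(\<^sup>k\<^sup>) 0 / \<phi> 0\<close>. The Leibniz rule for multiplication by \<open>x\<close> computes them by recursion on
the coefficient list of \<open>p\<close>, without ever forming the higher derivatives.\<close>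

definition gauss_deriv_at_0 :: "nat \<Rightarrow> real poly \<Rightarrow> real" where
  "gauss_deriv_at_0 k p = poly ((gauss_deriv ^^ k) p) 0"

lemma funpow_gauss_deriv_add: "(gauss_deriv ^^ k) (p + r) = (gauss_deriv ^^ k) p + (gauss_deriv ^^ k) r"
  by (induction k) (simp_all add: gauss_deriv_add)

lemma funpow_gauss_deriv_smult: "(gauss_deriv ^^ k) (smult c p) = smult c ((gauss_deriv ^^ k) p)"
  by (induction k) (simp_all add: gauss_deriv_smult)

lemma funpow_gauss_deriv_pCons_0:
  "(gauss_deriv ^^ Suc k) (pCons 0 p) = pCons 0 ((gauss_deriv ^^ Suc k) p) + smult (real (Suc k)) ((gauss_deriv ^^ k) p)"
proof (induction k)
  case 0
  show ?case by (simp add: gauss_deriv_def pderiv_pCons)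
next
  case (Suc k)
  have shift: "gauss_deriv (pCons 0 r) = pCons 0 (gauss_deriv r) + r" for r
    by (simp add: gauss_deriv_def pderiv_pCons)
  have "(gauss_deriv ^^ Suc (Suc k)) (pCons 0 p) = gauss_deriv ((gauss_deriv ^^ Suc k) (pCons 0 p))"
    by simp
  also have "\<dots> = pCons 0 ((gauss_deriv ^^ Suc (Suc k)) p) +
      (smult 1 ((gauss_deriv ^^ Suc k) p) + smult (real (Suc k)) ((gauss_deriv ^^ Suc k) p))"
    unfolding Suc.IH gauss_deriv_add gauss_deriv_smult shift by (simp add: add.assoc)
  also have "\<dots> = pCons 0 ((gauss_deriv ^^ Suc (Suc k)) p) + smult (real (Suc (Suc k))) ((gauss_deriv ^^ Suc k) p)"
    unfolding smult_add_left[symmetric] by (simp only: of_nat_Suc)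
  finally show ?case .
qed

lemma gauss_deriv_at_0_pCons:
  "gauss_deriv_at_0 0 (pCons a p) = a"
  "gauss_deriv_at_0 (Suc k) (pCons a p) = a * gauss_deriv_at_0 (Suc k) 1 + real (Suc k) * gauss_deriv_at_0 k p"
proof -
  have "pCons a p = smult a 1 + pCons 0 p" by (simp add: one_pCons)
  then show "gauss_deriv_at_0 (Suc k) (pCons a p) = a * gauss_deriv_at_0 (Suc k) 1 + real (Suc k) * gauss_deriv_at_0 k p"
    unfolding gauss_deriv_at_0_def
    by (simp only: funpow_gauss_deriv_add funpow_gauss_deriv_smult funpow_gauss_deriv_pCons_0) simp
qed (simp add: gauss_deriv_at_0_def)

lemma gauss_deriv_at_0_0: "gauss_deriv_at_0 k 0 = 0"
proof -
  have "gauss_deriv 0 = 0" by (simp add: gauss_deriv_def)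
  then have "(gauss_deriv ^^ k) 0 = 0" by (induction k) simp_all
  then show ?thesis by (simp add: gauss_deriv_at_0_def)
qed

lemma gauss_deriv_at_0_1:
  "gauss_deriv_at_0 (Suc 0) 1 = 0"
  "gauss_deriv_at_0 (Suc (Suc k)) 1 = - real (Suc k) * gauss_deriv_at_0 k 1"
proof -
  have D1: "gauss_deriv 1 = smult (-1) (pCons 0 1)"
    by (simp add: gauss_deriv_def pderiv_pCons one_pCons)
  show "gauss_deriv_at_0 (Suc 0) 1 = 0" by (simp add: gauss_deriv_at_0_def D1)
  have "(gauss_deriv ^^ Suc (Suc k)) 1 = (gauss_deriv ^^ Suc k) (gauss_deriv 1)"
    by (simp only: funpow_Suc_right o_apply)
  then show "gauss_deriv_at_0 (Suc (Suc k)) 1 = - real (Suc k) * gauss_deriv_at_0 k 1"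
    unfolding gauss_deriv_at_0_def D1
    by (simp only: funpow_gauss_deriv_smult funpow_gauss_deriv_pCons_0) (simp add: algebra_simps)
qed

lemma gauss_deriv_at_0_1_values:
  "gauss_deriv_at_0 2 1 = -1" "gauss_deriv_at_0 3 1 = 0" "gauss_deriv_at_0 4 1 = 3"
  "gauss_deriv_at_0 5 1 = 0" "gauss_deriv_at_0 6 1 = -15" "gauss_deriv_at_0 7 1 = 0"
  by (simp_all add: numeral_eq_Suc gauss_deriv_at_0_1, simp_all add: gauss_deriv_at_0_def)

lemma gauss_deriv_at_0_pCons_numeral:
  "gauss_deriv_at_0 (numeral n) (pCons a p) =
     a * gauss_deriv_at_0 (numeral n) 1 + numeral n * gauss_deriv_at_0 (pred_numeral n) p"
  using gauss_deriv_at_0_pCons(2)[of "pred_numeral n" a p]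
  by (simp only: numeral_eq_Suc[symmetric] of_nat_numeral)

lemma tail_taylor_coeff_numeral:
  "tail_taylor_coeff (Suc 0) p = gauss_deriv_at_0 0 p * std_normal_density 0"
  "tail_taylor_coeff (numeral n) p =
     (-1) ^ pred_numeral n / fact (numeral n) * gauss_deriv_at_0 (pred_numeral n) p * std_normal_density 0"
  by (simp_all add: tail_taylor_coeff_Suc gauss_deriv_at_0_def numeral_eq_Suc del: fact_Suc)

text \<open>The power of \<open>x\<close> serves as an accumulator: it allows half-line means to be evaluated along a coefficient
list.\<close>

definition half_moment :: "nat \<Rightarrow> real poly \<Rightarrow> real" where
  "half_moment k p = half_gauss_mean (monom 1 k * p)"

lemma half_moment_0: "half_moment k 0 = 0"
  by (simp add: half_moment_def half_gauss_mean_def)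

lemma half_moment_pCons: "half_moment k (pCons a p) = a * half_gauss_mean (monom 1 k) + half_moment (Suc k) p"
proof -
  have "monom 1 k * pCons a p = smult a (monom 1 k) + monom 1 (Suc k) * p"
    by (simp add: monom_Suc)
  then show ?thesis by (simp add: half_moment_def half_gauss_mean_add half_gauss_mean_smult)
qed

lemma half_gauss_mean_monom:
  "half_gauss_mean (monom 1 0) = 1 / 2"
  "half_gauss_mean (monom 1 (Suc 0)) = std_normal_density 0"
  "half_gauss_mean (monom 1 (Suc (Suc k))) = real (Suc k) * half_gauss_mean (monom 1 k)"
proof -
  show "half_gauss_mean (monom 1 0) = 1 / 2" using half_gauss_mean_1 by (simp add: one_pCons monom_0)
  have "gauss_deriv 1 = smult (-1) (monom 1 (Suc 0))"
    by (simp add: gauss_deriv_def pderiv_pCons one_pCons monom_Suc monom_0)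
  then show "half_gauss_mean (monom 1 (Suc 0)) = std_normal_density 0"
    using half_gauss_mean_gauss_deriv[of 1] by (simp only: half_gauss_mean_smult) simp
  have "gauss_deriv (monom 1 (Suc k)) = smult (real (Suc k)) (monom 1 k) + smult (-1) (monom 1 (Suc (Suc k)))"
    by (simp add: gauss_deriv_def pderiv_monom smult_monom minus_monom flip: monom_Suc)
  then show "half_gauss_mean (monom 1 (Suc (Suc k))) = real (Suc k) * half_gauss_mean (monom 1 k)"
    using half_gauss_mean_gauss_deriv[of "monom 1 (Suc k)"]
    by (simp only: half_gauss_mean_add half_gauss_mean_smult) (simp add: poly_monom)
qed

lemma half_gauss_mean_monom_values:
  "half_gauss_mean (monom 1 2) = 1 / 2" "half_gauss_mean (monom 1 3) = 2 * std_normal_density 0"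
  "half_gauss_mean (monom 1 4) = 3 / 2" "half_gauss_mean (monom 1 5) = 8 * std_normal_density 0"
  "half_gauss_mean (monom 1 6) = 15 / 2" "half_gauss_mean (monom 1 7) = 48 * std_normal_density 0"
  by (simp_all only: numeral_eq_Suc pred_numeral_simps half_gauss_mean_monom BitM.simps)

lemma half_gauss_mean_eq_half_moment: "half_gauss_mean p = half_moment 0 p"
  by (simp add: half_moment_def)

lemma monom_numeral: "monom c (numeral n) = pCons 0 (monom c (pred_numeral n))"
  by (simp add: numeral_eq_Suc monom_Suc)

text \<open>The last two rules unroll the sums of the recursion with numeral indices: without the reversed
\<open>numeral_2_eq_2\<close>, the index after 1 would remain \<open>Suc (Suc 0)\<close> and the rules for numerals would miss it.\<close>

lemmas recursion_evaluation =
  tail_taylor_coeff_numeral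
  gauss_deriv_at_0_pCons(1) gauss_deriv_at_0_pCons(2)[of 0, simplified] gauss_deriv_at_0_pCons_numeral
  gauss_deriv_at_0_0 gauss_deriv_at_0_1(1) gauss_deriv_at_0_1_values
  monom_numeral monom_Suc monom_0 sum.atLeast_Suc_atMost numeral_2_eq_2[symmetric]

lemmas half_gauss_mean_evaluation =
  half_gauss_mean_eq_half_moment[of "pCons _ _"] half_moment_0 half_moment_pCons
  half_gauss_mean_monom(1,2) half_gauss_mean_monom_values numeral_2_eq_2[symmetric]

text \<open>Every \<open>P m\<close> has coefficients in the ring of rational polynomials in \<open>s = \<phi> 0\<close>. Each step of the recursion
is evaluated there, and powers of \<open>pi\<close> enter only at the end, through \<open>s\<^sup>2 = 1 / (2 * pi)\<close>.\<close>

lemma eigenvalue_coefficients: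
  fixes P :: "nat \<Rightarrow> real poly" and K :: "nat \<Rightarrow> real"
  assumes K: "\<And>m. K m = half_gauss_mean (P m)" and P_0: "P 0 = 1"
    and P: "\<And>M. 1 \<le> M \<Longrightarrow> P M = smult 2 ((\<Sum>j=1..M. monom (tail_taylor_coeff j (P (M - j))) j) -
       (\<Sum>j=1..M - 1. smult (K j) (P (M - j))))"
  shows "K 1 = 1 / pi"
    and "K 2 = - (2 / pi ^ 2)"
    and "K 3 = - (5 / (6 * pi)) + 8 / pi ^ 3"
    and "K 4 = 13 / (3 * pi ^ 2) - 40 / pi ^ 4"
    and "K 5 = 23 / (40 * pi) - 28 / pi ^ 3 + 224 / pi ^ 5"
    and "K 6 = - (1069 / (180 * pi ^ 2)) + 580 / (3 * pi ^ 4) - 1344 / pi ^ 6"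
    and "K 7 = - (37 / (112 * pi)) + 842 / (15 * pi ^ 3) - 4144 / (3 * pi ^ 5) + 8448 / pi ^ 7"
    and "K 8 = 943 / (168 * pi ^ 2) - 1535 / (3 * pi ^ 4) + 10080 / pi ^ 6 - 54912 / pi ^ 8"
proof -
  define s where "s = std_normal_density 0"
  note s = s_def[symmetric]
  have P0: "P 0 = [:1:]" by (simp add: P_0 one_pCons)
  \<comment> \<open>Each evaluation leaves at most an identity between rational polynomials in \<open>s\<close>.\<close>
  have P1: "P (Suc 0) = [:0, 2 * s:]"
    by (subst P, simp, simp add: recursion_evaluation s P0)
       (simp add: field_simps eval_nat_numeral)?
  have K1: "K (Suc 0) = 2 * s ^ 2"
    by (simp add: K[of "Suc 0"] half_gauss_mean_evaluation s P1)
       (simp add: field_simps eval_nat_numeral)?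
  have P2: "P 2 = [:0, - (8 * s ^ 3):]"
    by (subst P, simp, simp add: recursion_evaluation s P0 P1 K1)
       (simp add: field_simps eval_nat_numeral)?
  have K2: "K 2 = - (8 * s ^ 4)"
    by (simp add: K[of 2] half_gauss_mean_evaluation s P2)
       (simp add: field_simps eval_nat_numeral)?
  have P3: "P 3 = [:0, 64 * s ^ 5, - (2 * s ^ 2), - (1 / 3 * s):]"
    by (subst P, simp, simp add: recursion_evaluation s P0 P1 K1 P2 K2)
       (simp add: field_simps eval_nat_numeral)?
  have K3: "K 3 = - (5 / 3 * s ^ 2) + 64 * s ^ 6"
    by (simp add: K[of 3] half_gauss_mean_evaluation s P3)
       (simp add: field_simps eval_nat_numeral)?
  have P4: "P 4 = [:0, 20 / 3 * s ^ 3 - 640 * s ^ 7, 16 * s ^ 4, 4 / 3 * s ^ 3:]"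
    by (subst P, simp, simp add: recursion_evaluation s P0 P1 K1 P2 K2 P3 K3)
       (simp add: field_simps eval_nat_numeral)?
  have K4: "K 4 = 52 / 3 * s ^ 4 - 640 * s ^ 8"
    by (simp add: K[of 4] half_gauss_mean_evaluation s P4)
       (simp add: field_simps eval_nat_numeral)?
  have P5: "P 5 = [:0,
      - (368 / 3 * s ^ 5) + 7168 * s ^ 9,
      - (160 * s ^ 6),
      - (32 / 3 * s ^ 5),
      1 / 2 * s ^ 2,
      1 / 20 * s:]"
    by (subst P, simp, simp add: recursion_evaluation s P0 P1 K1 P2 K2 P3 K3 P4 K4)
       (simp add: field_simps eval_nat_numeral)?
  have K5: "K 5 = 23 / 20 * s ^ 2 - 224 * s ^ 6 + 7168 * s ^ 10"
    by (simp add: K[of 5] half_gauss_mean_evaluation s P5)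
       (simp add: field_simps eval_nat_numeral)?
  have P6: "P 6 = [:0,
      - (23 / 5 * s ^ 3) + 1984 * s ^ 7 - 86016 * s ^ 11,
      - (40 / 3 * s ^ 4) + 1792 * s ^ 8,
      - (22 / 9 * s ^ 3) + 320 / 3 * s ^ 7,
      - (4 * s ^ 4),
      - (1 / 5 * s ^ 3):]"
    by (subst P, simp, simp add: recursion_evaluation s P0 P1 K1 P2 K2 P3 K3 P4 K4 P5 K5)
       (simp add: field_simps eval_nat_numeral)?
  have K6: "K 6 = - (1069 / 45 * s ^ 4) + 9280 / 3 * s ^ 8 - 86016 * s ^ 12"
    by (simp add: K[of 6] half_gauss_mean_evaluation s P6)
       (simp add: field_simps eval_nat_numeral)?
  have P7: "P 7 = [:0,
      6932 / 45 * s ^ 5 - 93184 / 3 * s ^ 9 + 1081344 * s ^ 13,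
      896 / 3 * s ^ 6 - 21504 * s ^ 10,
      328 / 9 * s ^ 5 - 3584 / 3 * s ^ 9,
      1 / 6 * s ^ 2 + 40 * s ^ 6,
      8 / 5 * s ^ 5,
      - (1 / 12 * s ^ 2),
      - (1 / 168 * s):]"
    by (subst P, simp, simp add: recursion_evaluation s P0 P1 K1 P2 K2 P3 K3 P4 K4 P5 K5 P6 K6)
       (simp add: field_simps eval_nat_numeral)?
  have K7: "K 7 = - (37 / 56 * s ^ 2) + 6736 / 15 * s ^ 6 - 132608 / 3 * s ^ 10 + 1081344 * s ^ 14"
    by (simp add: K[of 7] half_gauss_mean_evaluation s P7)
       (simp add: field_simps eval_nat_numeral)?
  have P8: "P 8 = [:0,
      37 / 14 * s ^ 3 - 10960 / 3 * s ^ 7 + 481280 * s ^ 11 - 14057472 * s ^ 15,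
      46 / 5 * s ^ 4 - 5376 * s ^ 8 + 270336 * s ^ 12,
      23 / 30 * s ^ 3 - 1568 / 3 * s ^ 7 + 14336 * s ^ 11,
      2 * s ^ 4 - 448 * s ^ 8,
      17 / 30 * s ^ 3 - 16 * s ^ 7,
      2 / 3 * s ^ 4,
      1 / 42 * s ^ 3:]"
    by (subst P, simp, simp add: recursion_evaluation s P0 P1 K1 P2 K2 P3 K3 P4 K4 P5 K5 P6 K6 P7 K7)
       (simp add: field_simps eval_nat_numeral)?
  have K8: "K 8 = 943 / 42 * s ^ 4 - 24560 / 3 * s ^ 8 + 645120 * s ^ 12 - 14057472 * s ^ 16"
    by (simp add: K[of 8] half_gauss_mean_evaluation s P8)
       (simp add: field_simps eval_nat_numeral)?
  have s_even: "s ^ (2 * n) = 1 / (2 * pi) ^ n" for n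
    by (simp add: power_mult s_def std_normal_density_def power_divide)
  note s_powers = s_even[of 1, simplified] s_even[of 2, simplified] s_even[of 3, simplified]
    s_even[of 4, simplified] s_even[of 5, simplified] s_even[of 6, simplified]
    s_even[of 7, simplified] s_even[of 8, simplified]
  show "K 1 = 1 / pi"
    and "K 2 = - (2 / pi ^ 2)"
    and "K 3 = - (5 / (6 * pi)) + 8 / pi ^ 3"
    and "K 4 = 13 / (3 * pi ^ 2) - 40 / pi ^ 4"
    and "K 5 = 23 / (40 * pi) - 28 / pi ^ 3 + 224 / pi ^ 5"
    and "K 6 = - (1069 / (180 * pi ^ 2)) + 580 / (3 * pi ^ 4) - 1344 / pi ^ 6"
    and "K 7 = - (37 / (112 * pi)) + 842 / (15 * pi ^ 3) - 4144 / (3 * pi ^ 5) + 8448 / pi ^ 7"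
    and "K 8 = 943 / (168 * pi ^ 2) - 1535 / (3 * pi ^ 4) + 10080 / pi ^ 6 - 54912 / pi ^ 8"
    using K1 K2 K3 K4 K5 K6 K7 K8 by (simp_all add: s_powers power_mult_distrib field_simps)
qed

section \<open>The expansion theorem\<close>

lemma poly_map_poly_of_real: "poly (map_poly of_real p) (of_real x) = of_real (poly p x)"
  by (induction p) (simp_all add: map_poly_pCons)

theorem theorem3:
  fixes q R :: real
    and f :: "real \<Rightarrow> real \<Rightarrow> complex"
    and K :: "nat \<Rightarrow> real"
    and g :: "nat \<Rightarrow> real \<Rightarrow> complex"
  assumes q: "0 < q" "q < 1"
    and R: "0 < R" "R \<le> sqrt ((1 - q) / (1 + inverse q))"
    and f_mem: "\<And>\<rho>. \<bar>\<rho>\<bar> < R \<Longrightarrow> f \<rho> \<in> Hq q"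
    and f_eigen: "\<And>\<rho>. \<bar>\<rho>\<bar> < R \<Longrightarrow>
      T_op \<rho> (f \<rho>) = (\<lambda>x. of_real (Hq_spectral_radius q (T_op \<rho>)) * f \<rho> x)"
    and f_normalized: "\<And>\<rho>. \<bar>\<rho>\<bar> < R \<Longrightarrow> f \<rho> 0 = 1"
    and eigenvalue_expansion: "\<And>\<rho>. \<bar>\<rho>\<bar> < R \<Longrightarrow>
      (\<lambda>k. \<rho> ^ k * K k) sums Hq_spectral_radius q (T_op \<rho>)"
    and g_mem: "\<And>m. g m \<in> Hq q"
    and eigenfunction_expansion: "\<And>\<rho>. \<bar>\<rho>\<bar> < R \<Longrightarrow>
      (\<lambda>N. Hq_norm q (\<lambda>x. f \<rho> x - (\<Sum>m<N. of_real (\<rho> ^ m) * g m x))) \<longlonglongrightarrow> 0"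
  shows "(\<forall>m. \<exists>p :: complex poly. degree p \<le> m \<and> (\<forall>x. g m x = poly p (of_real x)))
    \<and> g 0 = (\<lambda>x. 1)
    \<and> (\<forall>m\<ge>1. g m 0 = 0)
    \<and> (\<forall>m\<ge>1. g m = (\<lambda>x. 1 / of_real (K 0) *
          ((\<Sum>j=1..m. T_coeff j (g (m - j)) x)
           - (\<Sum>j=1..m - 1. T_coeff 0 (g j) x * g (m - j) x))))
    \<and> (\<forall>n\<ge>1. T_coeff 0 (g n) = (\<lambda>x. of_real (K n)))
    \<and> K 0 = 1 / 2
    \<and> K 1 = 1 / pi
    \<and> K 2 = - (2 / pi ^ 2)
    \<and> K 3 = - (5 / (6 * pi)) + 8 / pi ^ 3
    \<and> K 4 = 13 / (3 * pi ^ 2) - 40 / pi ^ 4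
    \<and> K 5 = 23 / (40 * pi) - 28 / pi ^ 3 + 224 / pi ^ 5
    \<and> K 6 = - (1069 / (180 * pi ^ 2)) + 580 / (3 * pi ^ 4) - 1344 / pi ^ 6
    \<and> K 7 = - (37 / (112 * pi)) + 842 / (15 * pi ^ 3) - 4144 / (3 * pi ^ 5) + 8448 / pi ^ 7
    \<and> K 8 = 943 / (168 * pi ^ 2) - 1535 / (3 * pi ^ 4) + 10080 / pi ^ 6 - 54912 / pi ^ 8"
proof -
  interpret hermite_space q by (unfold_locales; rule q)
  interpret eigen_expansion q R f "\<lambda>\<rho>. Hq_spectral_radius q (T_op \<rho>)" K g
    by unfold_locales
       (fact R spectral_radius_T_op_0 f_mem f_eigen f_normalized eigenvalue_expansion g_mem
          eigenfunction_expansion)+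
  show ?thesis
  proof (rule poly_recursion)
    fix P
    assume P: "\<And>m. degree (P m) \<le> m" "\<And>m. g m = (\<lambda>x. of_real (poly (P m) x))"
      and numbers: "\<And>m. K m = half_gauss_mean (P m)" "P 0 = 1"
      "\<And>M. 1 \<le> M \<Longrightarrow> P M = smult 2 ((\<Sum>j=1..M. monom (tail_taylor_coeff j (P (M - j))) j) -
         (\<Sum>j=1..M - 1. smult (K j) (P (M - j))))"
    have polys: "\<exists>p :: complex poly. degree p \<le> m \<and> (\<forall>x. g m x = poly p (of_real x))" for m
      using P by (intro exI[of _ "map_poly of_real (P m)"])
        (auto simp: poly_map_poly_of_real degree_map_poly)
    have rec: "g m = (\<lambda>x. 1 / of_real (K 0) *
        ((\<Sum>j=1..m. T_coeff j (g (m - j)) x) - (\<Sum>j=1..m - 1. T_coeff 0 (g j) x * g (m - j) x)))"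
      if "1 \<le> m" for m
      using recursion[OF that] by (rule ext)
    show ?thesis
      by (intro conjI allI impI polys g_0 rec K_0 eigenvalue_coefficients[OF numbers])
         (auto simp: g_at_0 K_eq)
  qed
qed

end
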